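(* Let $\mathbb{F}$ be an algebraically closed field of characteristic zero, $k\ge1$, $n=2k+2$, $\lambda=(\lambda_1,\dots,\lambda_k)\in(\mathbb{F}^\times)^k$, and let $\Gamma$ be a $G$-grading on the twisted Heisenberg algebra $L=H_n^\lambda$. Let $0\neq z\in\mathcal{Z}(L)$. Then there exist $u\in L$, integers $l\ge1$ and $s,r\ge0$ such that $l(r+2s)=2k=n-2$ (with $r=0$ when $l$ is odd), and scalars $\beta_1,\dots,\beta_s,\alpha_1,\dots,\alpha_r\in\{\pm\lambda_1,\dots,\pm\lambda_k\}$ such that $$\{z,u\}\cup\Big(\bigcup_{j=1}^sB_l^{\mathrm{I}}(u,\beta_j)\Big)\cup\Big(\bigcup_{i=1}^rB_{l/2}^{\mathrm{II}}(u,\alpha_i)\Big)$$ is a basis of $L$ consisting of homogeneous elements of $\Gamma$, for suitable blocks $B_l^{\mathrm{I}}(u,\beta_j)$ of type I and $B_{l/2}^{\mathrm{II}}(u,\alpha_i)$ of type II in $L$, the bracket of any two elements belonging to different blocks being zero.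
   Context: The twisted Heisenberg algebra $H_n^\lambda$ ($n=2k+2$) is the Lie algebra with basis $\{z,u,e_1,\hat e_1,\dots,e_k,\hat e_k\}$ whose nonvanishing brackets (up to skew-symmetry) are $[e_i,\hat e_i]=\lambda_iz$, $[u,e_i]=\lambda_i\hat e_i$, $[u,\hat e_i]=\lambda_ie_i$, $1\le i\le k$. Its center $\mathcal{Z}(H_n^\lambda)$ is the line spanned by $z$. A $G$-grading on an algebra $A$ is a decomposition $A=\bigoplus_{g\in G}A_g$ with $A_gA_h\subset A_{g+h}$, $G$ a finitely generated abelian group. Blocks. Let $L$ be a Lie algebra, $z\in L$ a fixed element, $u\in L$, $\alpha\in\mathbb{F}^\times$, $l\ge1$. A block of type I, $B_l^{\mathrm{I}}(u,\alpha)=\{x_1,y_1,\dots,x_l,y_l\}$, is a family of $2l$ linearly independent elements of $L$ such that the only nonvanishing products (up to skew-symmetry) among $u$ and these elements are: $[u,x_i]=\alpha x_{i+1}$ and $[u,y_i]=\alpha y_{i+1}$ for $1\le i\le l-1$; $[u,x_l]=\alpha x_1$; $[u,y_l]=(-1)^l\alpha y_1$; $[x_i,y_{l-i}]=(-1)^{l-i}\alpha z$ for $1\le i\le l-1$; $[x_l,y_l]=(-1)^l\alpha z$. A block of type II, $B_l^{\mathrm{II}}(u,\alpha)=\{x_1,\dots,x_{2l}\}$, is a family of $2l$ linearly independent elements of $L$ such that the only nonvanishing products (up to skew-symmetry) among $u$ and these elements are: $[u,x_i]=\alpha x_{i+1}$ for $1\le i\le 2l$ (indices modulo $2l$); $[x_i,x_{2l-i+1}]=(-1)^i\alpha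 z$ for $1\le i\le 2l$. *)

theory Defs
  imports "HOL-Computational_Algebra.Computational_Algebra"
begin

text \<open>
  The whole type \<open>'v\<close> is the underlying vector space of the Lie algebra; \<open>br x y\<close> is the
  bracket \<open>[x, y]\<close>.
\<close>

locale lie_algebra = vector_space scale
  for scale :: "'f::field \<Rightarrow> 'v::ab_group_add \<Rightarrow> 'v" +
  fixes br :: "'v \<Rightarrow> 'v \<Rightarrow> 'v"
  assumes br_linear_right: "Vector_Spaces.linear scale scale (\<lambda>y. br x y)"
    and br_linear_left: "Vector_Spaces.linear scale scale (\<lambda>x. br x y)"
    and br_self: "br x x = 0"
    and jacobi: "br x (br y z) + br y (br z x) + br z (br x y) = 0"
begin

definition center :: "'v set" where
  "center = {z. \<forall>x. br z x = 0}"

definition is_basis :: "'v set \<Rightarrow> bool" where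
  "is_basis B \<longleftrightarrow> independent B \<and> span B = UNIV"

text \<open>
  \<open>\<Gamma> g\<close> is the homogeneous component of degree \<open>g\<close>. The second clause says that the space is
  the internal direct sum of the components.
\<close>

definition is_grading :: "('g::ab_group_add \<Rightarrow> 'v set) \<Rightarrow> bool" where
  "is_grading \<Gamma> \<longleftrightarrow>
     (\<forall>g. subspace (\<Gamma> g)) \<and>
     (\<forall>x. \<exists>!c. (\<forall>g. c g \<in> \<Gamma> g) \<and> finite {g. c g \<noteq> 0} \<and> (\<Sum>g | c g \<noteq> 0. c g) = x) \<and>
     (\<forall>g h. \<forall>x \<in> \<Gamma> g. \<forall>y \<in> \<Gamma> h. br x y \<in> \<Gamma> (g + h))"

text \<open>
  Blocks are families indexed by \<open>{1..l}\<close> (twice) and by \<open>{1..2 * l}\<close>. Linear independence of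
  the family is independence of its set of members together with the members being distinct,
  which is what the cardinality condition expresses.
\<close>

definition block_I :: "'v \<Rightarrow> 'v \<Rightarrow> 'f \<Rightarrow> nat \<Rightarrow> (nat \<Rightarrow> 'v) \<Rightarrow> (nat \<Rightarrow> 'v) \<Rightarrow> bool" where
  "block_I z u \<alpha> l x y \<longleftrightarrow>
     l \<ge> 1 \<and> \<alpha> \<noteq> 0 \<and>
     independent (x ` {1..l} \<union> y ` {1..l}) \<and> card (x ` {1..l} \<union> y ` {1..l}) = 2 * l \<and>
     (\<forall>i \<in> {1..<l}. br u (x i) = scale \<alpha> (x (i + 1))) \<and>
     (\<forall>i \<in> {1..<l}. br u (y i) = scale \<alpha> (y (i + 1))) \<and>
     br u (x l) = scale \<alpha> (x 1) \<and>
     br u (y l) = scale ((-1) ^ l * \<alpha>) (y 1) \<and>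
     (\<forall>i \<in> {1..<l}. br (x i) (y (l - i)) = scale ((-1) ^ (l - i) * \<alpha>) z) \<and>
     br (x l) (y l) = scale ((-1) ^ l * \<alpha>) z \<and>
     (\<forall>i \<in> {1..l}. \<forall>j \<in> {1..l}. br (x i) (x j) = 0) \<and>
     (\<forall>i \<in> {1..l}. \<forall>j \<in> {1..l}. br (y i) (y j) = 0) \<and>
     (\<forall>i \<in> {1..l}. \<forall>j \<in> {1..l}.
        i + j \<noteq> l \<and> \<not> (i = l \<and> j = l) \<longrightarrow> br (x i) (y j) = 0)"

definition block_II :: "'v \<Rightarrow> 'v \<Rightarrow> 'f \<Rightarrow> nat \<Rightarrow> (nat \<Rightarrow> 'v) \<Rightarrow> bool" where
  "block_II z u \<alpha> l x \<longleftrightarrow>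
     l \<ge> 1 \<and> \<alpha> \<noteq> 0 \<and>
     independent (x ` {1..2 * l}) \<and> card (x ` {1..2 * l}) = 2 * l \<and>
     (\<forall>i \<in> {1..<2 * l}. br u (x i) = scale \<alpha> (x (i + 1))) \<and>
     br u (x (2 * l)) = scale \<alpha> (x 1) \<and>
     (\<forall>i \<in> {1..2 * l}. br (x i) (x (2 * l - i + 1)) = scale ((-1) ^ i * \<alpha>) z) \<and>
     (\<forall>i \<in> {1..2 * l}. \<forall>j \<in> {1..2 * l}. i + j \<noteq> 2 * l + 1 \<longrightarrow> br (x i) (x j) = 0)"

definition brackets_vanish :: "'v set \<Rightarrow> 'v set \<Rightarrow> bool" where
  "brackets_vanish A B \<longleftrightarrow> (\<forall>a \<in> A. \<forall>b \<in> B. br a b = 0)"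

end

definition block_I_set :: "nat \<Rightarrow> (nat \<Rightarrow> 'v) \<Rightarrow> (nat \<Rightarrow> 'v) \<Rightarrow> 'v set" where
  "block_I_set l x y = x ` {1..l} \<union> y ` {1..l}"

definition block_II_set :: "nat \<Rightarrow> (nat \<Rightarrow> 'v) \<Rightarrow> 'v set" where
  "block_II_set l x = x ` {1..2 * l}"

definition homogeneous :: "('g \<Rightarrow> 'v set) \<Rightarrow> 'v \<Rightarrow> bool" where
  "homogeneous \<Gamma> x \<longleftrightarrow> (\<exists>g. x \<in> \<Gamma> g)"

definition finitely_generated :: "'g::ab_group_add itself \<Rightarrow> bool" where
  "finitely_generated _ \<longleftrightarrow> (\<exists>S :: 'g set. finite S \<and> group_closure S = UNIV)"

text \<open>
  The parameters \<open>z0, u0, e i, e' i\<close> (for \<open>1 \<le> i \<le> k\<close>) are the members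
  \<open>z\<close>, \<open>u\<close>, \<open>e\<^sub>i\<close>, \<open>e-hat\<^sub>i\<close> of the defining basis; \<open>basis_card\<close> says that they are pairwise
  distinct.
\<close>

locale twisted_heisenberg = lie_algebra scale br
  for scale :: "'f::field \<Rightarrow> 'v::ab_group_add \<Rightarrow> 'v" and br :: "'v \<Rightarrow> 'v \<Rightarrow> 'v" +
  fixes k :: nat and lam :: "nat \<Rightarrow> 'f"
    and z0 u0 :: 'v and e e' :: "nat \<Rightarrow> 'v"
  assumes basis: "is_basis ({z0, u0} \<union> e ` {1..k} \<union> e' ` {1..k})"
    and basis_card: "card ({z0, u0} \<union> e ` {1..k} \<union> e' ` {1..k}) = 2 * k + 2"
    and br_e_e': "i \<in> {1..k} \<Longrightarrow> br (e i) (e' i) = scale (lam i) z0"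
    and br_u_e: "i \<in> {1..k} \<Longrightarrow> br u0 (e i) = scale (lam i) (e' i)"
    and br_u_e': "i \<in> {1..k} \<Longrightarrow> br u0 (e' i) = scale (lam i) (e i)"
    and br_z_u: "br z0 u0 = 0"
    and br_z_e: "i \<in> {1..k} \<Longrightarrow> br z0 (e i) = 0"
    and br_z_e': "i \<in> {1..k} \<Longrightarrow> br z0 (e' i) = 0"
    and br_e_e: "i \<in> {1..k} \<Longrightarrow> j \<in> {1..k} \<Longrightarrow> br (e i) (e j) = 0"
    and br_e'_e': "i \<in> {1..k} \<Longrightarrow> j \<in> {1..k} \<Longrightarrow> br (e' i) (e' j) = 0"
    and br_e_e'_distinct: "i \<in> {1..k} \<Longrightarrow> j \<in> {1..k} \<Longrightarrow> i \<noteq> j \<Longrightarrow> br (e i) (e' j) = 0"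

end

theory Submission
  imports Defs
begin

text \<open>
  The space \<open>L\<close> is the span of \<open>u0\<close> and a Heisenberg algebra \<open>H\<close> (the span of \<open>z0\<close> and all \<open>e i\<close>,
  \<open>e' i\<close>), and \<open>H\<close> is an ideal whose brackets lie on the central line. Since homogeneous elements
  span \<open>L\<close>, one of them lies outside \<open>H\<close>; scaled suitably it is \<open>u = u0 + v\<close> with \<open>v\<close> in \<open>H\<close>. Up to
  central corrections \<open>ad u\<close> has the eigenvectors \<open>e i + e' i\<close> and \<open>e i - e' i\<close> with eigenvalues
  \<open>lam i\<close> and \<open>- lam i\<close>. Their span \<open>W\<close> is the image of \<open>ad u\<close>, hence graded, and
  \<open>L\<close> is the direct sum of \<open>W\<close> and the plane through \<open>z\<close> and \<open>u\<close>. The bracket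
  on \<open>W\<close> is a symplectic form with values in the line of \<open>z\<close>, which is homogeneous of some degree
  \<open>d\<close>, and \<open>ad u\<close> is invertible on \<open>W\<close> and skew for the form (\<open>twisted_heisenberg_reduction\<close>).

  Let \<open>h\<close> be the degree of \<open>u\<close>. Because \<open>ad u\<close> is invertible on the finite-dimensional \<open>W\<close> and
  shifts degrees by \<open>h\<close>, the order \<open>l\<close> of \<open>h\<close> is finite, and \<open>(ad u)^l\<close> preserves every homogeneous
  component of \<open>W\<close>. It is diagonalisable there, with eigenvalues that are \<open>l\<close>-th powers of numbers
  \<open>\<alpha> = \<plusminus> lam i\<close>. An eigenvector \<open>x\<close> starts the chain \<open>(ad u)^i x / \<alpha>^i\<close>, which closes up to sign
  after \<open>l\<close> steps, and blocks are made of one or two such chains.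

  Two homogeneous eigenvectors \<open>x\<close>, \<open>y\<close> that are not orthogonal have degrees with sum \<open>d\<close>. If
  these differ by no multiple of \<open>h\<close>, the chains of \<open>x\<close> and \<open>y\<close> are isotropic and form a block of
  type I. Otherwise both vectors can be moved along their chains into a common degree \<open>p\<close> such that
  \<open>d\<close> is \<open>2 p\<close> or \<open>2 p + h\<close>. If \<open>d = 2 p\<close>, each chain is again isotropic and they form a block of type
  I. The case \<open>d = 2 p + h\<close> reduces to the previous one when \<open>l\<close> is odd; when \<open>l\<close> is even,
  \<open>[v, [u, v]]\<close> is a quadratic form on the eigenspace in degree \<open>p\<close> that does not vanish identically,
  and a vector with nonzero value, scaled by a square root, starts a block of type II
  (\<open>block_from_pair\<close>).

  All blocks, and all unions of mutually orthogonal blocks, are sets in which every element has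
  exactly one partner with which its bracket is nonzero. Such sets are independent and they split
  off orthogonally, compatibly with degrees (\<open>orth_projection\<close>). So as long as a family of
  blocks does not span \<open>W\<close>, its complement contains a further block (\<open>block_in_complement\<close>), and a
  family with as many blocks as possible spans \<open>W\<close> (\<open>spanning_block_family\<close>).
\<close>

section \<open>Brackets\<close>

context lie_algebra
begin

lemma br_add_right: "br x (y + y') = br x y + br x y'"
  and br_scale_right: "br x (scale c y) = scale c (br x y)"
  using br_linear_right[of x] unfolding Vector_Spaces.linear_iff by auto

lemma br_add_left: "br (x + x') y = br x y + br x' y"
  and br_scale_left: "br (scale c x) y = scale c (br x y)"
  using br_linear_left[of y] unfolding Vector_Spaces.linear_iff by auto

lemma br_zero_right [simp]: "br x 0 = 0"
  using br_scale_right[of x 0 0] by simp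

lemma br_zero_left [simp]: "br 0 x = 0"
  using br_scale_left[of 0 0 x] by simp

lemma br_antisym: "br y x = - br x y"
proof -
  have "br (x + y) (x + y) = br x y + br y x"
    unfolding br_add_left br_add_right by (simp add: br_self)
  then show ?thesis by (simp add: br_self add_eq_0_iff)
qed

lemma br_eq_0_commute: "br x y = 0 \<longleftrightarrow> br y x = 0"
  by (metis br_antisym neg_equal_0_iff_equal)

lemma br_minus_right: "br x (- y) = - br x y"
  by (metis add.right_inverse br_add_right br_zero_right minus_unique)

lemma br_diff_left: "br (x - x') y = br x y - br x' y"
  by (metis br_add_left add_diff_cancel diff_add_cancel)

lemma br_diff_right: "br y (x - x') = br y x - br y x'"
  by (metis br_add_right add_diff_cancel diff_add_cancel)

lemma br_sum_left: "br (\<Sum>i\<in>I. f i) y = (\<Sum>i\<in>I. br (f i) y)"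
  by (induction I rule: infinite_finite_induct) (auto simp: br_add_left)

lemma br_sum_right: "br y (\<Sum>i\<in>I. f i) = (\<Sum>i\<in>I. br y (f i))"
  by (induction I rule: infinite_finite_induct) (auto simp: br_add_right)

lemma br_derivation: "br u (br x y) = br (br u x) y + br x (br u y)"
proof -
  have "br x (br y u) = - br x (br u y)" "br y (br u x) = - br (br u x) y"
    by (metis br_antisym br_minus_right, metis br_antisym)
  then show ?thesis
    using jacobi[of u x y] by (simp add: algebra_simps)
qed

lemma br_in_subspace_left:
  assumes "x \<in> span A" "subspace S" "\<And>a. a \<in> A \<Longrightarrow> br a y \<in> S"
  shows "br x y \<in> S"
  using assms(1)
  by (induction rule: span_induct_alt)
    (auto simp: br_add_left br_scale_left intro: subspace_add subspace_scale subspace_0 assms)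

lemma br_in_subspace_right:
  assumes "x \<in> span A" "subspace S" "\<And>a. a \<in> A \<Longrightarrow> br y a \<in> S"
  shows "br y x \<in> S"
  using assms(1)
  by (induction rule: span_induct_alt)
    (auto simp: br_add_right br_scale_right intro: subspace_add subspace_scale subspace_0 assms)

lemma br_span_eq_0_left: "x \<in> span A \<Longrightarrow> (\<And>a. a \<in> A \<Longrightarrow> br a y = 0) \<Longrightarrow> br x y = 0"
  using br_in_subspace_left[of x A "{0}" y] by (simp add: subspace_def)

lemma br_span_eq_0_right: "x \<in> span A \<Longrightarrow> (\<And>a. a \<in> A \<Longrightarrow> br y a = 0) \<Longrightarrow> br y x = 0"
  using br_in_subspace_right[of x A "{0}" y] by (simp add: subspace_def)

section \<open>Paired sets\<close>

text \<open>
  A set on which the bracket is a monomial matrix. Blocks, unions of mutually orthogonal blocks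
  and the eigenvector basis of the Heisenberg algebra all have this shape, and it is all that
  is needed to know that they are independent and that they split off orthogonally.
\<close>

definition paired :: "'v set \<Rightarrow> bool" where
  "paired B \<longleftrightarrow> (\<forall>b \<in> B. \<exists>!c. c \<in> B \<and> br b c \<noteq> 0)"

lemma paired_partnerE:
  assumes "paired B" "b \<in> B"
  obtains p where "p \<in> B" "br b p \<noteq> 0" "\<And>c. c \<in> B \<Longrightarrow> c \<noteq> b \<Longrightarrow> br c p = 0"
proof -
  obtain p where p: "p \<in> B" "br b p \<noteq> 0"
    using assms unfolding paired_def by blast
  have "br p b \<noteq> 0" using p br_eq_0_commute by blast
  moreover have "\<exists>!c. c \<in> B \<and> br p c \<noteq> 0"
    using assms(1) p(1) unfolding paired_def by blast
  ultimately have "br c p = 0" if "c \<in> B" "c \<noteq> b" for c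
    using that assms(2) br_eq_0_commute by metis
  then show ?thesis using that p by blast
qed

lemma paired_empty: "paired {}"
  by (simp add: paired_def)

text \<open>Bracketing a linear combination with the partner of \<open>b\<close> isolates the coefficient of \<open>b\<close>.\<close>

lemma paired_coefficient:
  assumes "paired B" "finite t" "t \<subseteq> B" "b \<in> t"
  shows "\<exists>p\<in>B. br b p \<noteq> 0 \<and> br (\<Sum>v\<in>t. scale (a v) v) p = scale (a b) (br b p)"
proof -
  obtain p where p: "p \<in> B" "br b p \<noteq> 0" "\<And>c. c \<in> B \<Longrightarrow> c \<noteq> b \<Longrightarrow> br c p = 0"
    using assms paired_partnerE[of B b] by blast
  have "br (\<Sum>v\<in>t. scale (a v) v) p = (\<Sum>v\<in>t. if v = b then scale (a v) (br v p) else 0)"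
    unfolding br_sum_left using p(3) assms(3) by (intro sum.cong) (auto simp: br_scale_left)
  then show ?thesis using p assms by auto
qed

lemma paired_independent:
  assumes "paired B" shows "independent B"
  unfolding independent_explicit_module
proof (intro allI impI)
  fix t a v assume t: "finite t" "t \<subseteq> B" "(\<Sum>v\<in>t. scale (a v) v) = 0" "v \<in> t"
  obtain p where "br v p \<noteq> 0" "br (\<Sum>v\<in>t. scale (a v) v) p = scale (a v) (br v p)"
    using paired_coefficient[OF assms t(1,2,4)] by blast
  then show "a v = 0" using t(3) by simp
qed

lemma paired_nondegenerate:
  assumes "paired B" "x \<in> span B" "x \<noteq> 0"
  shows "\<exists>p\<in>B. br x p \<noteq> 0"
proof -
  obtain t a where t: "finite t" "t \<subseteq> B" "x = (\<Sum>v\<in>t. scale (a v) v)"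
    using assms(2) unfolding span_explicit by blast
  then obtain b where b: "b \<in> t" "a b \<noteq> 0"
    using assms(3) by (metis (no_types, lifting) scale_zero_left sum.neutral)
  obtain p where "p \<in> B" "br b p \<noteq> 0" "br x p = scale (a b) (br b p)"
    using paired_coefficient[OF assms(1) t(1,2) b(1), of a] unfolding t(3) by blast
  with b(2) show ?thesis by (intro bexI[of _ p]) auto
qed

lemma paired_Un:
  assumes "paired A" "paired B" "brackets_vanish A B"
  shows "paired (A \<union> B)" "A \<inter> B = {}"
proof -
  have 0: "br a b = 0" "br b a = 0" if "a \<in> A" "b \<in> B" for a b
    using assms(3) that br_eq_0_commute unfolding brackets_vanish_def by blast+
  show "paired (A \<union> B)"
    unfolding paired_def
  proof
    fix b assume "b \<in> A \<union> B"
    then show "\<exists>!c. c \<in> A \<union> B \<and> br b c \<noteq> 0"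
      using assms(1,2) 0 unfolding paired_def by (metis Un_iff)
  qed
  show "A \<inter> B = {}"
    using assms(1) 0 unfolding paired_def by blast
qed

lemma brackets_vanish_commute: "brackets_vanish A B \<longleftrightarrow> brackets_vanish B A"
  unfolding brackets_vanish_def using br_eq_0_commute by blast

lemma brackets_vanish_UN_right:
  "brackets_vanish A (\<Union>i\<in>I. S i) \<longleftrightarrow> (\<forall>i\<in>I. brackets_vanish A (S i))"
  unfolding brackets_vanish_def by blast

lemma paired_UN:
  assumes "finite I" "\<And>i. i \<in> I \<Longrightarrow> paired (S i)"
    and "\<And>i j. i \<in> I \<Longrightarrow> j \<in> I \<Longrightarrow> i \<noteq> j \<Longrightarrow> brackets_vanish (S i) (S j)"
    and "\<And>i. i \<in> I \<Longrightarrow> finite (S i) \<and> card (S i) = m"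
  shows "paired (\<Union>i\<in>I. S i)" "card (\<Union>i\<in>I. S i) = card I * m"
proof -
  have "paired (\<Union>i\<in>I. S i) \<and> card (\<Union>i\<in>I. S i) = card I * m"
    using assms
  proof (induction I rule: finite_induct)
    case empty
    then show ?case by (simp add: paired_empty)
  next
    case (insert i I)
    have IH: "paired (\<Union>i\<in>I. S i)" "card (\<Union>i\<in>I. S i) = card I * m"
      using insert by simp_all
    have "brackets_vanish (S i) (\<Union>i\<in>I. S i)"
      unfolding brackets_vanish_UN_right using insert.hyps insert.prems(2) by blast
    note Un = paired_Un[OF insert.prems(1)[OF insertI1] IH(1) this]
    have "finite (S i)" "finite (\<Union>i\<in>I. S i)" "card (S i) = m"
      using insert.prems(3) insert.hyps(1) by auto
    then show ?case
      using Un IH(2) insert.hyps by (simp add: card_Un_disjoint)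
  qed
  then show "paired (\<Union>i\<in>I. S i)" "card (\<Union>i\<in>I. S i) = card I * m" by blast+
qed

section \<open>Blocks\<close>

lemma block_I_set_paired:
  assumes z: "z \<noteq> 0" and \<alpha>: "\<alpha> \<noteq> 0"
    and xy: "\<forall>i \<in> {1..<l}. br (x i) (y (l - i)) = scale ((-1) ^ (l - i) * \<alpha>) z"
      "br (x l) (y l) = scale ((-1) ^ l * \<alpha>) z"
    and xx: "\<forall>i \<in> {1..l}. \<forall>j \<in> {1..l}. br (x i) (x j) = 0"
    and yy: "\<forall>i \<in> {1..l}. \<forall>j \<in> {1..l}. br (y i) (y j) = 0"
    and xy0: "\<forall>i \<in> {1..l}. \<forall>j \<in> {1..l}. i + j \<noteq> l \<and> \<not> (i = l \<and> j = l) \<longrightarrow> br (x i) (y j) = 0"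
  shows "paired (block_I_set l x y)" "card (block_I_set l x y) = 2 * l"
proof -
  \<comment> \<open>The partner of the \<open>i\<close>-th element of one chain is the \<open>\<sigma> i\<close>-th of the other.\<close>
  define \<sigma> where "\<sigma> i = (if i = l then l else l - i)" for i :: nat
  have \<sigma>: "\<sigma> i \<in> {1..l}" "\<sigma> (\<sigma> i) = i" if "i \<in> {1..l}" for i
    using that by (auto simp: \<sigma>_def)
  have br_\<sigma>: "br (x i) (y j) \<noteq> 0 \<longleftrightarrow> j = \<sigma> i" if "i \<in> {1..l}" "j \<in> {1..l}" for i j
  proof
    assume "j = \<sigma> i"
    then show "br (x i) (y j) \<noteq> 0"
      using that xy z \<alpha> by (cases "i = l") (auto simp: \<sigma>_def)
  next
    assume "br (x i) (y j) \<noteq> 0"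
    then have "i + j = l \<or> i = l \<and> j = l" using xy0 that by blast
    then show "j = \<sigma> i" using that by (auto simp: \<sigma>_def)
  qed
  have br_\<sigma>': "br (y j) (x i) \<noteq> 0 \<longleftrightarrow> j = \<sigma> i" if "i \<in> {1..l}" "j \<in> {1..l}" for i j
    using br_\<sigma>[OF that] br_eq_0_commute by blast
  show "paired (block_I_set l x y)"
    unfolding paired_def block_I_set_def
  proof
    fix b assume "b \<in> x ` {1..l} \<union> y ` {1..l}"
    then consider i where "i \<in> {1..l}" "b = x i" | i where "i \<in> {1..l}" "b = y i" by blast
    then show "\<exists>!c. c \<in> x ` {1..l} \<union> y ` {1..l} \<and> br b c \<noteq> 0"
    proof cases
      case 1
      show ?thesis
      proof (rule ex1I[of _ "y (\<sigma> i)"])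
        show "y (\<sigma> i) \<in> x ` {1..l} \<union> y ` {1..l} \<and> br b (y (\<sigma> i)) \<noteq> 0"
          using 1 \<sigma>[of i] br_\<sigma>[of i "\<sigma> i"] by blast
        show "c = y (\<sigma> i)" if "c \<in> x ` {1..l} \<union> y ` {1..l} \<and> br b c \<noteq> 0" for c
          using that 1 br_\<sigma>[of i] xx by blast
      qed
    next
      case 2
      show ?thesis
      proof (rule ex1I[of _ "x (\<sigma> i)"])
        show "x (\<sigma> i) \<in> x ` {1..l} \<union> y ` {1..l} \<and> br b (x (\<sigma> i)) \<noteq> 0"
          using 2 \<sigma>[of i] br_\<sigma>'[of "\<sigma> i" i] by auto
        show "c = x (\<sigma> i)" if "c \<in> x ` {1..l} \<union> y ` {1..l} \<and> br b c \<noteq> 0" for c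
        proof -
          have "c \<in> x ` {1..l}" using that 2 yy by blast
          then obtain j where j: "j \<in> {1..l}" "c = x j" by blast
          then have "i = \<sigma> j" using that 2 br_\<sigma>'[of j i] by blast
          then show ?thesis using j \<sigma>(2)[of j] by simp
        qed
      qed
    qed
  qed
  have "inj_on x {1..l}"
  proof (rule inj_onI)
    fix i j assume ij: "i \<in> {1..l}" "j \<in> {1..l}" "x i = x j"
    then have "\<sigma> i = \<sigma> j" using br_\<sigma>[of i "\<sigma> i"] br_\<sigma>[of j "\<sigma> i"] \<sigma>[of i] by auto
    then show "i = j" using \<sigma>(2) ij by metis
  qed
  moreover have "inj_on y {1..l}"
  proof (rule inj_onI)
    fix i j assume ij: "i \<in> {1..l}" "j \<in> {1..l}" "y i = y j"
    have "br (x (\<sigma> i)) (y i) \<noteq> 0"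
      using br_\<sigma>[OF \<sigma>(1)[OF ij(1)] ij(1)] \<sigma>(2)[OF ij(1)] by simp
    then have "j = \<sigma> (\<sigma> i)"
      using br_\<sigma>[OF \<sigma>(1)[OF ij(1)] ij(2)] ij(3) by simp
    then show "i = j" using \<sigma>(2)[OF ij(1)] by simp
  qed
  moreover have "x ` {1..l} \<inter> y ` {1..l} = {}"
  proof (rule ccontr)
    assume "x ` {1..l} \<inter> y ` {1..l} \<noteq> {}"
    then obtain i j where ij: "i \<in> {1..l}" "j \<in> {1..l}" "x i = y j" by blast
    have "br (x i) (y (\<sigma> i)) \<noteq> 0" using br_\<sigma>[OF ij(1) \<sigma>(1)[OF ij(1)]] by simp
    then have "br (y j) (y (\<sigma> i)) \<noteq> 0" using ij(3) by simp
    then show False using yy ij \<sigma>(1)[of i] by blast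
  qed
  ultimately show "card (block_I_set l x y) = 2 * l"
    by (simp add: block_I_set_def card_Un_disjoint card_image)
qed

lemma block_II_set_paired:
  assumes z: "z \<noteq> 0" and \<alpha>: "\<alpha> \<noteq> 0"
    and ww: "\<forall>i \<in> {1..2 * l}. br (w i) (w (2 * l - i + 1)) = scale ((-1) ^ i * \<alpha>) z"
    and ww0: "\<forall>i \<in> {1..2 * l}. \<forall>j \<in> {1..2 * l}. i + j \<noteq> 2 * l + 1 \<longrightarrow> br (w i) (w j) = 0"
  shows "paired (block_II_set l w)" "card (block_II_set l w) = 2 * l"
proof -
  define \<sigma> where "\<sigma> i = 2 * l - i + 1" for i :: nat
  have \<sigma>: "\<sigma> i \<in> {1..2 * l}" "\<sigma> (\<sigma> i) = i" if "i \<in> {1..2 * l}" for i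
    using that by (auto simp: \<sigma>_def)
  have br_\<sigma>: "br (w i) (w j) \<noteq> 0 \<longleftrightarrow> j = \<sigma> i" if "i \<in> {1..2 * l}" "j \<in> {1..2 * l}" for i j
  proof
    assume "j = \<sigma> i"
    then show "br (w i) (w j) \<noteq> 0"
      using that ww z \<alpha> by (auto simp: \<sigma>_def)
  next
    assume "br (w i) (w j) \<noteq> 0"
    then have "i + j = 2 * l + 1" using ww0 that by blast
    then show "j = \<sigma> i" using that by (auto simp: \<sigma>_def)
  qed
  show "paired (block_II_set l w)"
    unfolding paired_def block_II_set_def
  proof
    fix b assume "b \<in> w ` {1..2 * l}"
    then obtain i where i: "i \<in> {1..2 * l}" "b = w i" by blast
    show "\<exists>!c. c \<in> w ` {1..2 * l} \<and> br b c \<noteq> 0"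
    proof (rule ex1I[of _ "w (\<sigma> i)"])
      show "w (\<sigma> i) \<in> w ` {1..2 * l} \<and> br b (w (\<sigma> i)) \<noteq> 0"
        using i \<sigma>[of i] br_\<sigma>[of i "\<sigma> i"] by blast
      show "c = w (\<sigma> i)" if "c \<in> w ` {1..2 * l} \<and> br b c \<noteq> 0" for c
        using that i br_\<sigma>[of i] by blast
    qed
  qed
  have "inj_on w {1..2 * l}"
  proof (rule inj_onI)
    fix i j assume ij: "i \<in> {1..2 * l}" "j \<in> {1..2 * l}" "w i = w j"
    then have "\<sigma> i = \<sigma> j" using br_\<sigma>[of i "\<sigma> i"] br_\<sigma>[of j "\<sigma> i"] \<sigma>[of i] by auto
    then show "i = j" using \<sigma>(2) ij by metis
  qed
  then show "card (block_II_set l w) = 2 * l"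
    by (simp add: block_II_set_def card_image)
qed

lemma block_I_paired:
  assumes "block_I z u \<alpha> l x y" "z \<noteq> 0"
  shows "paired (block_I_set l x y)" "card (block_I_set l x y) = 2 * l"
  by (rule block_I_set_paired[of z \<alpha>]; use assms in \<open>simp add: block_I_def\<close>)+

lemma block_II_paired:
  assumes "block_II z u \<alpha> l w" "z \<noteq> 0"
  shows "paired (block_II_set l w)" "card (block_II_set l w) = 2 * l"
  by (rule block_II_set_paired[of z \<alpha>]; use assms in \<open>simp add: block_II_def\<close>)+

lemma block_I_invariant:
  assumes "block_I z u \<alpha> l x y" "b \<in> block_I_set l x y"
  shows "br u b \<in> span (block_I_set l x y)"
proof -
  have l: "l \<ge> 1" using assms(1) unfolding block_I_def by blast
  have base: "x i \<in> span (block_I_set l x y)" "y i \<in> span (block_I_set l x y)" if "i \<in> {1..l}" for i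
    using that unfolding block_I_set_def by (auto intro: span_base)
  obtain i where i: "i \<in> {1..l}" "b = x i \<or> b = y i"
    using assms(2) unfolding block_I_set_def by blast
  show ?thesis
  proof (cases "i = l")
    case True
    then have "br u b = scale \<alpha> (x 1) \<or> br u b = scale ((-1) ^ l * \<alpha>) (y 1)"
      using i(2) assms(1) unfolding block_I_def by blast
    then show ?thesis using base[of 1] l span_scale by auto
  next
    case False
    then have "i \<in> {1..<l}" using i(1) by simp
    then have "br u b = scale \<alpha> (x (i + 1)) \<or> br u b = scale \<alpha> (y (i + 1))"
      using i(2) assms(1) unfolding block_I_def by blast
    then show ?thesis using base[of "i + 1"] \<open>i \<in> {1..<l}\<close> span_scale by auto
  qed
qed

lemma block_II_invariant:
  assumes "block_II z u \<alpha> l w" "b \<in> block_II_set l w"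
  shows "br u b \<in> span (block_II_set l w)"
proof -
  have l: "l \<ge> 1" using assms(1) unfolding block_II_def by blast
  have base: "w i \<in> span (block_II_set l w)" if "i \<in> {1..2 * l}" for i
    using that unfolding block_II_set_def by (auto intro: span_base)
  obtain i where i: "i \<in> {1..2 * l}" "b = w i"
    using assms(2) unfolding block_II_set_def by blast
  show ?thesis
  proof (cases "i = 2 * l")
    case True
    then have "br u b = scale \<alpha> (w 1)"
      using i(2) assms(1) unfolding block_II_def by blast
    then show ?thesis using base[of 1] l span_scale by auto
  next
    case False
    then have "i \<in> {1..<2 * l}" using i(1) by simp
    then have "br u b = scale \<alpha> (w (i + 1))"
      using i(2) assms(1) unfolding block_II_def by blast
    then show ?thesis using base[of "i + 1"] \<open>i \<in> {1..<2 * l}\<close> span_scale by auto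
  qed
qed

end

section \<open>Gradings\<close>

primrec multiple :: "nat \<Rightarrow> 'g::ab_group_add \<Rightarrow> 'g" where
  "multiple 0 h = 0"
| "multiple (Suc n) h = h + multiple n h"

lemma multiple_add: "multiple (m + n) h = multiple m h + multiple n h"
  by (induction m) (simp_all add: algebra_simps)

lemma multiple_zero_right [simp]: "multiple n 0 = 0"
  by (induction n) simp_all

lemma multiple_mult: "multiple (m * n) h = multiple m (multiple n h)"
  by (induction m) (simp_all add: multiple_add)

context lie_algebra
begin

lemma grading_subspace: "is_grading \<Gamma> \<Longrightarrow> subspace (\<Gamma> g)"
  unfolding is_grading_def by blast

lemma grading_br: "is_grading \<Gamma> \<Longrightarrow> x \<in> \<Gamma> g \<Longrightarrow> y \<in> \<Gamma> g' \<Longrightarrow> br x y \<in> \<Gamma> (g + g')"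
  unfolding is_grading_def by blast

lemma grading_span_homogeneous:
  assumes "is_grading \<Gamma>"
  shows "x \<in> span {y. homogeneous \<Gamma> y}"
proof -
  have "\<exists>!c. (\<forall>g. c g \<in> \<Gamma> g) \<and> finite {g. c g \<noteq> 0} \<and> (\<Sum>g | c g \<noteq> 0. c g) = x"
    using assms unfolding is_grading_def by blast
  then obtain c where c: "\<forall>g. c g \<in> \<Gamma> g" "(\<Sum>g | c g \<noteq> 0. c g) = x"
    by blast
  have "(\<Sum>g | c g \<noteq> 0. c g) \<in> span {y. homogeneous \<Gamma> y}"
    using c(1) unfolding homogeneous_def by (intro span_sum span_base) blast
  then show ?thesis using c(2) by simp
qed

text \<open>The uniqueness in the definition of a grading, compared with the zero decomposition.\<close>

lemma grading_sum_eq_0: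
  assumes \<Gamma>: "is_grading \<Gamma>" and D: "finite D" "\<And>g. g \<in> D \<Longrightarrow> c g \<in> \<Gamma> g" "(\<Sum>g\<in>D. c g) = 0"
    and "g \<in> D"
  shows "c g = 0"
proof -
  define c' where "c' g = (if g \<in> D then c g else 0)" for g
  have 0: "0 \<in> \<Gamma> g" for g
    using \<Gamma> by (simp add: grading_subspace subspace_0)
  have fin: "finite {g. c' g \<noteq> 0}"
    by (rule finite_subset[OF _ D(1)]) (auto simp: c'_def)
  have "(\<Sum>g | c' g \<noteq> 0. c' g) = (\<Sum>g\<in>D. c' g)"
    by (rule sum.mono_neutral_left) (use D(1) in \<open>auto simp: c'_def\<close>)
  also have "\<dots> = 0" using D(3) by (simp add: c'_def)
  finally have sum: "(\<Sum>g | c' g \<noteq> 0. c' g) = 0" .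
  define P where
    "P c \<longleftrightarrow> (\<forall>g. c g \<in> \<Gamma> g) \<and> finite {g. c g \<noteq> 0} \<and> (\<Sum>g | c g \<noteq> 0. c g) = 0" for c
  have "\<exists>!c. P c"
    using \<Gamma> unfolding is_grading_def P_def by blast
  then obtain c0 where "\<forall>c. P c \<longrightarrow> c = c0" by (elim ex1E) (rule that)
  moreover have "P c'"
    unfolding P_def using fin sum 0 D(2) by (auto simp: c'_def)
  moreover have "P (\<lambda>g. 0)"
    unfolding P_def using 0 by simp
  ultimately have "c' = (\<lambda>g. 0)" by metis
  then show ?thesis using \<open>g \<in> D\<close> unfolding c'_def by metis
qed

lemma grading_degree_unique:
  assumes "is_grading \<Gamma>" "x \<in> \<Gamma> g" "x \<in> \<Gamma> g'" "x \<noteq> 0"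
  shows "g = g'"
proof (rule ccontr)
  assume "g \<noteq> g'"
  define c where "c a = (if a = g then x else - x)" for a
  have "c g = 0"
  proof (rule grading_sum_eq_0[OF assms(1), of "{g, g'}" c])
    show "c a \<in> \<Gamma> a" if "a \<in> {g, g'}" for a
      using that assms grading_subspace subspace_neg unfolding c_def by auto
    show "(\<Sum>a\<in>{g, g'}. c a) = 0" using \<open>g \<noteq> g'\<close> by (simp add: c_def)
  qed auto
  then show False using assms(4) by (simp add: c_def)
qed

text \<open>
  Only finitely many degrees occur in a finite-dimensional space. For the images \<open>x n\<close> of a vector
  under the powers of an operator of degree \<open>h\<close>, none of them zero, two degrees must coincide.
\<close>

lemma grading_finite_order:
  fixes \<Gamma> :: "'g::ab_group_add \<Rightarrow> 'v set"
  assumes \<Gamma>: "is_grading \<Gamma>" and F: "finite F"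
    and x: "\<And>n. x n \<in> \<Gamma> (multiple n h + g)" "\<And>n. x n \<in> span F" "\<And>n. x n \<noteq> 0"
  shows "\<exists>n\<ge>1. multiple n h = 0"
proof (rule ccontr)
  assume no: "\<not> (\<exists>n\<ge>1. multiple n h = 0)"
  \<comment> \<open>Otherwise the \<open>x n\<close> have pairwise distinct degrees and are infinitely many independent vectors.\<close>
  have inj: "inj (\<lambda>n. multiple n h + g)"
  proof (rule linorder_injI)
    fix m n :: nat assume "m < n"
    then obtain j where "n = m + Suc j" using less_imp_Suc_add by fastforce
    then have "multiple n h = multiple m h + multiple (Suc j) h"
      using multiple_add by blast
    moreover have "multiple (Suc j) h \<noteq> 0" using no by (metis le_add1 plus_1_eq_Suc)
    ultimately show "multiple m h + g \<noteq> multiple n h + g" by simp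
  qed
  have injx: "inj x"
  proof (rule injI)
    fix m n assume "x m = x n"
    then have "multiple m h + g = multiple n h + g"
      using grading_degree_unique[OF \<Gamma> x(1)[of m] _ x(3)] x(1)[of n] by simp
    then show "m = n" using inj unfolding inj_def by blast
  qed
  have "independent (range x)"
    unfolding independent_explicit_module
  proof (intro allI impI)
    fix t a v assume t: "finite t" "t \<subseteq> range x" "(\<Sum>v\<in>t. scale (a v) v) = 0" "v \<in> t"
    define N where "N = x -` t"
    have N: "finite N" "t = x ` N"
      using t injx by (auto simp: N_def finite_vimageI)
    define \<delta> where "\<delta> n = multiple n h + g" for n
    have inj\<delta>: "inj \<delta>" using inj unfolding \<delta>_def .
    define c where "c a' = (let n = inv \<delta> a' in scale (a (x n)) (x n))" for a'
    have c: "c (\<delta> n) = scale (a (x n)) (x n)" for n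
      by (simp add: c_def inv_f_f[OF inj\<delta>])
    obtain n where n: "n \<in> N" "v = x n" using t(4) N(2) by blast
    have "c (\<delta> n) = 0"
    proof (rule grading_sum_eq_0[OF \<Gamma>, of "\<delta> ` N"])
      have "(\<Sum>g\<in>\<delta> ` N. c g) = (\<Sum>n\<in>N. scale (a (x n)) (x n))"
        using inj\<delta> by (subst sum.reindex) (auto simp: c inj_on_def inj_def)
      also have "\<dots> = (\<Sum>v\<in>t. scale (a v) v)"
        unfolding N(2) using injx by (subst sum.reindex) (auto simp: inj_on_def inj_def)
      finally show "(\<Sum>g\<in>\<delta> ` N. c g) = 0" using t(3) by simp
      show "c a' \<in> \<Gamma> a'" if "a' \<in> \<delta> ` N" for a'
        using that x(1) grading_subspace[OF \<Gamma>] subspace_scale c unfolding \<delta>_def by fastforce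
    qed (use N n in auto)
    then show "a v = 0" using c x(3) n by simp
  qed
  then have "finite (range x)"
    using independent_span_bound[OF F] x(2) by blast
  then show False using injx finite_imageD by blast
qed

section \<open>Eigenvectors in invariant subspaces\<close>

text \<open>
  Applying \<open>S - a\<close> removes the summand for the eigenvalue \<open>a\<close> and rescales the others by nonzero
  factors, which is the induction step.
\<close>

lemma eigencomponents_in_invariant_subspace:
  assumes S: "\<And>x y. S (x + y) = S x + S y" "\<And>c x. S (scale c x) = scale c (S x)"
    and N: "subspace N" "\<And>x. x \<in> N \<Longrightarrow> S x \<in> N"
    and A: "finite A" "\<And>a. a \<in> A \<Longrightarrow> S (w a) = scale a (w a)" "(\<Sum>a\<in>A. w a) \<in> N" "a \<in> A"
  shows "w a \<in> N"
proof -
  have S0: "S 0 = 0" using S(2)[of 0 0] by simp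
  have "\<forall>a\<in>A. w a \<in> N" using A(1-3)
  proof (induction A arbitrary: w rule: finite_induct)
    case (insert a A)
    let ?v = "\<Sum>b\<in>insert a A. w b"
    have "S (\<Sum>b\<in>B. w b) = (\<Sum>b\<in>B. S (w b))" for B
      by (induction B rule: infinite_finite_induct) (auto simp: S S0)
    then have "S ?v = (\<Sum>b\<in>insert a A. scale b (w b))"
      using insert.prems(1) by auto
    then have "S ?v - scale a ?v = (\<Sum>b\<in>insert a A. scale (b - a) (w b))"
      by (simp add: scale_sum_right scale_left_diff_distrib sum_subtractf)
    also have "\<dots> = (\<Sum>b\<in>A. scale (b - a) (w b))" using insert.hyps by simp
    finally have "(\<Sum>b\<in>A. scale (b - a) (w b)) = S ?v - scale a ?v" by (rule sym)
    then have "(\<Sum>b\<in>A. scale (b - a) (w b)) \<in> N"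
      using subspace_diff[OF N(1) N(2)[OF insert.prems(2)] subspace_scale[OF N(1) insert.prems(2)]]
      by simp
    then have *: "\<forall>b\<in>A. scale (b - a) (w b) \<in> N"
      using insert.prems(1) by (intro insert.IH) (auto simp: S mult.commute)
    have wA: "\<forall>b\<in>A. w b \<in> N"
    proof
      fix b assume b: "b \<in> A"
      then have "scale (1 / (b - a)) (scale (b - a) (w b)) \<in> N"
        using * N(1) subspace_scale by blast
      moreover have "b \<noteq> a" using b insert.hyps by blast
      ultimately show "w b \<in> N" by simp
    qed
    then have "?v - (\<Sum>b\<in>A. w b) \<in> N"
      using N(1) by (intro subspace_diff insert.prems(2) subspace_sum) auto
    then show ?case using wA insert.hyps by simp
  qed simp
  then show ?thesis using A(4) by blast
qed

end

section \<open>Graded Heisenberg algebras with a homogeneous derivation\<close>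

text \<open>
  The situation to which the twisted Heisenberg algebra is reduced: \<open>u\<close> is homogeneous, the
  eigenvectors \<open>F\<close> of \<open>ad u\<close> span a graded subspace, and the bracket restricted to that subspace
  is a nondegenerate alternating form with values in the line through \<open>z\<close>.
\<close>

locale graded_heisenberg = lie_algebra scale br
  for scale :: "'f::{alg_closed_field, field_char_0} \<Rightarrow> 'v::ab_group_add \<Rightarrow> 'v"
    and br :: "'v \<Rightarrow> 'v \<Rightarrow> 'v" +
  fixes \<Gamma> :: "'g::ab_group_add \<Rightarrow> 'v set" and z u :: 'v and d h :: 'g
    and F :: "'v set" and \<Lambda> :: "'f set"
  assumes grading: "is_grading \<Gamma>"
    and z: "z \<noteq> 0" "z \<in> \<Gamma> d" "br z x = 0"
    and u: "u \<in> \<Gamma> h"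
    and F: "finite F" "F \<noteq> {}" "paired F"
    and F_eigenvector: "f \<in> F \<Longrightarrow> \<exists>\<mu>\<in>\<Lambda>. br u f = scale \<mu> f"
    and F_br: "f \<in> F \<Longrightarrow> f' \<in> F \<Longrightarrow> br f f' \<in> span {z}"
    and eigenvalue_nonzero: "0 \<notin> \<Lambda>"
    and F_graded: "span F \<subseteq> span {x \<in> span F. homogeneous \<Gamma> x}"
begin

abbreviation T :: "nat \<Rightarrow> 'v \<Rightarrow> 'v" where
  "T n \<equiv> (br u ^^ n)"

abbreviation W :: "'v set" where
  "W \<equiv> span F"

lemma T_add: "T n (x + y) = T n x + T n y"
  by (induction n) (simp_all add: br_add_right)

lemma T_scale: "T n (scale c x) = scale c (T n x)"
  by (induction n) (simp_all add: br_scale_right)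

lemma T_T: "T m (T n x) = T (m + n) x"
  by (simp add: funpow_add)

lemma T_eigenvector: "T n x = scale c x \<Longrightarrow> T (m * n) x = scale (c ^ m) x"
  by (induction m) (simp_all add: funpow_add T_scale ac_simps)

lemma ad_u_W: "x \<in> W \<Longrightarrow> br u x \<in> W"
proof (rule br_in_subspace_right[of x F W u])
  show "br u f \<in> W" if "f \<in> F" for f
    using F_eigenvector[OF that] span_base[OF that] span_scale by auto
qed simp_all

lemma T_W: "x \<in> W \<Longrightarrow> T n x \<in> W"
  by (induction n) (simp_all add: ad_u_W)

lemma T_degree: "x \<in> \<Gamma> g \<Longrightarrow> T n x \<in> \<Gamma> (multiple n h + g)"
proof (induction n)
  case (Suc n)
  then have "br u (T n x) \<in> \<Gamma> (h + (multiple n h + g))"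
    using grading_br[OF grading u] by blast
  then show ?case by (simp add: add.assoc)
qed simp

lemma br_W: assumes "x \<in> W" "y \<in> W" shows "\<exists>c. br x y = scale c z"
proof -
  have "br x y \<in> span {z}"
    using assms F_br
    by (intro br_in_subspace_left[OF assms(1)] br_in_subspace_right[OF assms(2)]) auto
  then show ?thesis by (auto simp: span_singleton)
qed

lemma br_u_z: "br u z = 0"
  using z(3) br_eq_0_commute by blast

text \<open>The Leibniz rule for \<open>ad u\<close>, which annihilates the values \<open>c z\<close> of the form.\<close>

lemma ad_u_skew: "x \<in> W \<Longrightarrow> y \<in> W \<Longrightarrow> br (br u x) y = - br x (br u y)"
  using br_derivation[of u x y] br_W[of x y] br_u_z
  by (auto simp: br_scale_right add_eq_0_iff)

lemma T_skew: "x \<in> W \<Longrightarrow> y \<in> W \<Longrightarrow> br (T n x) y = scale ((-1) ^ n) (br x (T n y))"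
proof (induction n arbitrary: y)
  case (Suc n)
  have "br (T (Suc n) x) y = - br (T n x) (br u y)"
    using Suc.prems by (simp add: ad_u_skew T_W)
  also have "\<dots> = - scale ((-1) ^ n) (br x (T n (br u y)))"
    using Suc by (simp add: ad_u_W)
  also have "T n (br u y) = T (Suc n) y" by (simp add: funpow_swap1)
  finally show ?case by simp
qed simp

lemma W_nondegenerate: "x \<in> W \<Longrightarrow> x \<noteq> 0 \<Longrightarrow> \<exists>y\<in>W. br x y \<noteq> 0"
  using paired_nondegenerate[OF F(3)] span_base by blast

lemma br_degree:
  assumes "x \<in> W" "y \<in> W" "x \<in> \<Gamma> g" "y \<in> \<Gamma> g'" "br x y \<noteq> 0"
  shows "g + g' = d"
proof -
  obtain c where "br x y = scale c z" using br_W assms by blast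
  then have "br x y \<in> \<Gamma> d"
    using z(2) grading_subspace[OF grading] subspace_scale by metis
  moreover have "br x y \<in> \<Gamma> (g + g')" using grading_br[OF grading] assms by blast
  ultimately show ?thesis using grading_degree_unique[OF grading] assms(5) by blast
qed

lemma ad_u_surj: "x \<in> W \<Longrightarrow> \<exists>y\<in>W. br u y = x"
proof (induction rule: span_induct_alt)
  case base
  then show ?case using span_zero by (intro bexI[of _ 0]) auto
next
  case (step c x y)
  obtain \<mu> where \<mu>: "\<mu> \<in> \<Lambda>" "br u x = scale \<mu> x" using F_eigenvector step by blast
  obtain y' where y': "y' \<in> W" "br u y' = y" using step by blast
  have "\<mu> \<noteq> 0" using \<mu>(1) eigenvalue_nonzero by blast
  then have "br u (scale (c / \<mu>) x + y') = scale c x + y"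
    using \<mu> y' by (simp add: br_add_right br_scale_right)
  moreover have "scale (c / \<mu>) x + y' \<in> W"
    using span_add[OF span_scale[OF span_base[OF step(1)]] y'(1)] .
  ultimately show ?case by blast
qed

text \<open>A skew surjective operator is injective: its kernel is orthogonal to its image.\<close>

lemma T_nonzero: assumes "x \<in> W" "x \<noteq> 0" shows "T n x \<noteq> 0"
proof (induction n)
  case (Suc n)
  have W: "T n x \<in> W" using T_W assms by blast
  then obtain y where y: "y \<in> W" "br (T n x) y \<noteq> 0" using W_nondegenerate Suc by blast
  then obtain y' where y': "y' \<in> W" "br u y' = y" using ad_u_surj by blast
  have "br (br u (T n x)) y' \<noteq> 0" using ad_u_skew[OF W y'(1)] y y' by simp
  then show ?case by auto
qed (use assms in simp)

subsection \<open>The order of the degree of the derivation\<close>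

text \<open>The common length of all chains: \<open>T l\<close> is the first positive power of \<open>ad u\<close> that preserves degrees.\<close>

definition l :: nat where
  "l = (LEAST n. n \<ge> 1 \<and> multiple n h = 0)"

lemma l_properties: "l \<ge> 1 \<and> multiple l h = 0"
proof -
  have "F \<noteq> {0}" using F(3) unfolding paired_def by auto
  then obtain f where f: "f \<in> F" "f \<noteq> 0" using F(2) by blast
  then have "f \<in> span {x \<in> W. homogeneous \<Gamma> x}" using F_graded span_base by blast
  then have "\<not> {x \<in> W. homogeneous \<Gamma> x} \<subseteq> {0}"
    using f(2) span_mono[of _ "{0}"] by (metis singletonD span_empty span_insert_0 subsetD)
  then obtain x g where x: "x \<in> W" "x \<in> \<Gamma> g" "x \<noteq> 0" unfolding homogeneous_def by blast
  have "\<exists>n\<ge>1. multiple n h = 0"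
    by (rule grading_finite_order[OF grading F(1), of "\<lambda>n. T n x" h g])
      (use x T_degree T_W T_nonzero in blast)+
  then show ?thesis
    unfolding l_def by (rule LeastI_ex)
qed

lemma l_pos: "l \<ge> 1" and multiple_l: "multiple l h = 0"
  using l_properties by blast+

lemma multiple_eq_0_iff: "multiple n h = 0 \<longleftrightarrow> l dvd n"
proof
  assume "l dvd n"
  then obtain q where "n = q * l" by (metis dvd_def mult.commute)
  then show "multiple n h = 0" by (simp add: multiple_mult multiple_l)
next
  assume 0: "multiple n h = 0"
  have "multiple n h = multiple (n div l * l) h + multiple (n mod l) h"
    unfolding multiple_add[symmetric] by simp
  then have "multiple (n mod l) h = 0"
    using 0 by (simp add: multiple_mult multiple_l)
  moreover have "n mod l < l" using l_pos by simp
  ultimately have "\<not> n mod l \<ge> 1"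
    using not_less_Least[of "n mod l" "\<lambda>n. n \<ge> 1 \<and> multiple n h = 0"] unfolding l_def by blast
  then show "l dvd n" by (simp add: dvd_eq_mod_eq_0)
qed

text \<open>
  Detecting eigenvectors by pairing them with \<open>x\<close> gives at once the existence of eigenvectors in
  an invariant subspace and the choice of one that is not orthogonal to a given vector.
\<close>

lemma paired_eigenvector:
  assumes N: "subspace N" "N \<subseteq> W" "\<And>v. v \<in> N \<Longrightarrow> T n v \<in> N" and v: "v \<in> N" "br x v \<noteq> 0"
  shows "\<exists>y\<in>N. \<exists>\<mu>\<in>\<Lambda>. T n y = scale (\<mu> ^ n) y \<and> br x y \<noteq> 0"
proof -
  obtain a where a: "v = (\<Sum>f\<in>F. scale (a f) f)"
    using v(1) N(2) span_finite[OF F(1)] by auto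
  obtain \<mu> where \<mu>: "\<And>f. f \<in> F \<Longrightarrow> \<mu> f \<in> \<Lambda>" "\<And>f. f \<in> F \<Longrightarrow> br u f = scale (\<mu> f) f"
    using F_eigenvector by metis
  \<comment> \<open>The eigencomponents of \<open>v\<close> for \<open>T n\<close>; several eigenvalues of \<open>ad u\<close> may have the same power.\<close>
  define w where "w \<nu> = (\<Sum>f | f \<in> F \<and> \<mu> f ^ n = \<nu>. scale (a f) f)" for \<nu>
  let ?A = "(\<lambda>f. \<mu> f ^ n) ` F"
  have sum: "(\<Sum>\<nu>\<in>?A. w \<nu>) = v"
    unfolding w_def a using F(1) by (intro sum.group) auto
  have T_sum: "T n (\<Sum>f\<in>B. g f) = (\<Sum>f\<in>B. T n (g f))" for B and g :: "'v \<Rightarrow> 'v"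
    using T_scale[of n 0 0] by (induction B rule: infinite_finite_induct) (auto simp: T_add)
  have T_f: "T n f = scale (\<mu> f ^ n) f" if "f \<in> F" for f
    using T_eigenvector[of 1 f "\<mu> f" n] \<mu>(2)[OF that] by simp
  have w: "T n (w \<nu>) = scale \<nu> (w \<nu>)" for \<nu>
    unfolding w_def T_sum scale_sum_right
    by (intro sum.cong) (auto simp: T_scale T_f mult.commute)
  have wN: "w \<nu> \<in> N" if "\<nu> \<in> ?A" for \<nu>
    by (rule eigencomponents_in_invariant_subspace[of "T n" N ?A w])
      (use that N v sum w F(1) in \<open>auto simp: T_add T_scale\<close>)
  have "br x v = (\<Sum>\<nu>\<in>?A. br x (w \<nu>))"
    using sum br_sum_right by metis
  then obtain \<nu> where "\<nu> \<in> ?A" "br x (w \<nu>) \<noteq> 0"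
    using v(2) sum.neutral by metis
  then show ?thesis using wN w \<mu>(1) by blast
qed

subsection \<open>Orthogonal complements\<close>

definition orth :: "'v set \<Rightarrow> 'v set" where
  "orth B = {w \<in> W. \<forall>b\<in>B. br w b = 0}"

lemma orth_subspace: "subspace (orth B)"
  unfolding orth_def by (rule subspaceI)
    (auto simp: span_zero span_add span_scale br_add_left br_scale_left)

lemma orth_W: "orth B \<subseteq> W"
  unfolding orth_def by blast

text \<open>
  The coefficient of \<open>b\<close> in the projection of \<open>m\<close> to the span of \<open>B\<close> is read off by pairing with
  the partner of \<open>b\<close>. It vanishes unless \<open>m\<close> and \<open>b\<close> have the same degree, so the projection
  preserves degrees.
\<close>

lemma orth_projection:
  assumes B: "paired B" "finite B" "B \<subseteq> W" "\<forall>b\<in>B. homogeneous \<Gamma> b"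
    and m: "m \<in> W" "m \<in> \<Gamma> g"
  shows "\<exists>m'\<in>orth B. m' \<in> \<Gamma> g \<and> m - m' \<in> span B"
proof -
  have "\<exists>p c. p \<in> B \<and> br b p \<noteq> 0 \<and> (\<forall>c\<in>B. c \<noteq> b \<longrightarrow> br c p = 0)
      \<and> br m p = scale c (br b p) \<and> scale c b \<in> \<Gamma> g" if b: "b \<in> B" for b
  proof -
    obtain p where p: "p \<in> B" "br b p \<noteq> 0" "\<And>c. c \<in> B \<Longrightarrow> c \<noteq> b \<Longrightarrow> br c p = 0"
      using paired_partnerE[OF B(1) b] by blast
    have W: "b \<in> W" "p \<in> W" using b p B by blast+
    obtain s t where s: "br m p = scale s z" and t: "br b p = scale t z"
      using br_W W m by meson
    have "t \<noteq> 0" using t p(2) by auto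
    then have "br m p = scale (s / t) (br b p)" using s t by simp
    moreover have "scale (s / t) b \<in> \<Gamma> g"
    proof (cases "s = 0")
      case False
      obtain a a' where a: "b \<in> \<Gamma> a" "p \<in> \<Gamma> a'"
        using B(4) b p unfolding homogeneous_def by blast
      have "g + a' = d" using br_degree[OF m(1) W(2) m(2) a(2)] False s z(1) by simp
      moreover have "a + a' = d" using br_degree[OF W a p(2)] .
      ultimately have "a = g" by (metis add_right_cancel)
      then show ?thesis using a grading_subspace[OF grading] subspace_scale by blast
    qed (simp add: subspace_0 grading_subspace[OF grading])
    ultimately show ?thesis using p by blast
  qed
  then obtain p c where p: "\<And>b. b \<in> B \<Longrightarrow> p b \<in> B \<and> br b (p b) \<noteq> 0"
    and p0: "\<And>b c. b \<in> B \<Longrightarrow> c \<in> B \<Longrightarrow> c \<noteq> b \<Longrightarrow> br c (p b) = 0"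
    and c: "\<And>b. b \<in> B \<Longrightarrow> br m (p b) = scale (c b) (br b (p b)) \<and> scale (c b) b \<in> \<Gamma> g"
    by metis
  define s where "s = (\<Sum>b\<in>B. scale (c b) b)"
  have s: "s \<in> span B" "s \<in> \<Gamma> g"
    unfolding s_def using c grading_subspace[OF grading]
    by (auto intro: span_sum span_scale span_base subspace_sum)
  have "br (m - s) (p b) = 0" if b: "b \<in> B" for b
  proof -
    have "br s (p b) = (\<Sum>b'\<in>B. if b' = b then br (scale (c b) b) (p b) else 0)"
      unfolding s_def br_sum_left using p0[OF b] by (intro sum.cong) (auto simp: br_scale_left)
    also have "\<dots> = br m (p b)" using b B(2) c by (simp add: br_scale_left)
    finally show ?thesis by (simp add: br_diff_left)
  qed
  moreover have "p (p b) = b" if b: "b \<in> B" for b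
  proof (rule ccontr)
    assume "p (p b) \<noteq> b"
    then have "br (p (p b)) (p b) = 0" using p p0 b by blast
    then show False using p b br_eq_0_commute by blast
  qed
  ultimately have "\<forall>b\<in>B. br (m - s) b = 0" using p by metis
  moreover have "m - s \<in> W"
    using m(1) s(1) span_minimal[OF B(3) subspace_span] span_diff by blast
  ultimately have "m - s \<in> orth B" unfolding orth_def by blast
  moreover have "m - s \<in> \<Gamma> g" using m(2) s(2) subspace_diff grading_subspace[OF grading] by blast
  ultimately show ?thesis using s(1) by (intro bexI[of _ "m - s"]) auto
qed

end

section \<open>Constructing blocks from eigenvectors\<close>

context graded_heisenberg
begin

text \<open>Normalised so that \<open>ad u\<close> acts on every chain as the shift times the constant factor \<open>\<alpha>\<close>.\<close>

definition chain :: "'f \<Rightarrow> 'v \<Rightarrow> nat \<Rightarrow> 'v" where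
  "chain \<alpha> x i = scale (inverse (\<alpha> ^ i)) (T i x)"

lemma chain_step: "\<alpha> \<noteq> 0 \<Longrightarrow> br u (chain \<alpha> x i) = scale \<alpha> (chain \<alpha> x (Suc i))"
  by (simp add: chain_def br_scale_right)

lemma chain_period: "\<alpha> \<noteq> 0 \<Longrightarrow> T l x = scale (c * \<alpha> ^ l) x \<Longrightarrow> chain \<alpha> x l = scale c x"
  by (simp add: chain_def)

lemma chain_br:
  assumes "x \<in> W" "y \<in> W"
  shows "br (chain \<alpha> x i) (chain \<alpha> y j)
    = scale ((-1) ^ i * inverse (\<alpha> ^ (i + j))) (br x (T (i + j) y))"
proof -
  have "br (T i x) (T j y) = scale ((-1) ^ i) (br x (T (i + j) y))"
    using T_skew[OF assms(1) T_W[OF assms(2)]] T_T by simp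
  then show ?thesis
    by (simp add: chain_def br_scale_left br_scale_right power_add mult.commute mult.left_commute)
qed

lemma T_invariant: "(\<And>v. v \<in> S \<Longrightarrow> br u v \<in> S) \<Longrightarrow> v \<in> S \<Longrightarrow> T n v \<in> S"
  by (induction n) auto

lemma chain_invariant:
  assumes "subspace S" "\<And>v. v \<in> S \<Longrightarrow> br u v \<in> S" "x \<in> S"
  shows "chain \<alpha> x i \<in> S"
  unfolding chain_def using assms T_invariant[of S x] subspace_scale by blast

lemma chain_homogeneous: "x \<in> \<Gamma> g \<Longrightarrow> homogeneous \<Gamma> (chain \<alpha> x i)"
  unfolding chain_def homogeneous_def
  using T_degree grading_subspace[OF grading] subspace_scale by blast

text \<open>
  The chains through \<open>x\<close> and a multiple of \<open>y\<close> form a block of type I. A bracket between the two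
  chains can only be nonzero if the exponents of \<open>ad u\<close> add up to a multiple of \<open>l\<close>, for reasons of
  degree; skew-symmetry of \<open>ad u\<close> then reduces it to the bracket of \<open>x\<close> and \<open>y\<close>.
\<close>

lemma block_I_exists:
  assumes S: "subspace S" "S \<subseteq> W" "\<And>v. v \<in> S \<Longrightarrow> br u v \<in> S"
    and x: "x \<in> S" "x \<in> \<Gamma> g" "T l x = scale (\<alpha> ^ l) x"
    and y: "y \<in> S" "y \<in> \<Gamma> g'" "T l y = scale ((-1) ^ l * \<alpha> ^ l) y"
    and \<alpha>: "\<alpha> \<noteq> 0" and xy: "br x y \<noteq> 0"
    and iso: "\<And>n. br x (T n x) = 0" "\<And>n. br y (T n y) = 0"
  shows "\<exists>X Y. block_I z u \<alpha> l X Y \<and> block_I_set l X Y \<subseteq> S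
    \<and> (\<forall>b\<in>block_I_set l X Y. homogeneous \<Gamma> b)"
proof -
  have W: "x \<in> W" "y \<in> W" using x y S by blast+
  obtain c where c: "br x y = scale c z" using br_W W by blast
  have "c \<noteq> 0" using c xy by auto
  define y0 where "y0 = scale (\<alpha> / c) y"
  have y0: "y0 \<in> S" "y0 \<in> W" "y0 \<in> \<Gamma> g'" "T l y0 = scale ((-1) ^ l * \<alpha> ^ l) y0"
    using y W S grading_subspace[OF grading] subspace_scale
    unfolding y0_def by (auto simp: T_scale mult.commute span_scale)
  have xy0: "br x y0 = scale \<alpha> z"
    using c \<open>c \<noteq> 0\<close> by (simp add: y0_def br_scale_right)
  have iso0: "br y0 (T n y0) = 0" for n
    using iso(2)[of n] by (simp add: y0_def T_scale br_scale_left br_scale_right)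
  define X Y where "X = chain \<alpha> x" and "Y = chain \<alpha> y0"
  have XY: "br (X i) (Y j) = scale ((-1) ^ i * inverse (\<alpha> ^ (i + j))) (br x (T (i + j) y0))" for i j
    unfolding X_def Y_def using chain_br W y0 by blast
  have degree: "l dvd n" if "br x (T n y0) \<noteq> 0" for n
  proof -
    have "g + (multiple n h + g') = d"
      using br_degree[OF W(1) T_W[OF y0(2)] x(2) T_degree[OF y0(3)] that] .
    moreover have "g + g' = d" using br_degree[OF W x(2) y(2) xy] .
    ultimately have "multiple n h = 0" by (metis add.left_cancel add_cancel_left_left)
    then show ?thesis by (simp add: multiple_eq_0_iff)
  qed
  have *: "i + j = l \<or> i = l \<and> j = l"
    if ij: "i \<in> {1..l}" "j \<in> {1..l}" "br (X i) (Y j) \<noteq> 0" for i j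
  proof -
    have "l dvd i + j" using ij(3) XY degree by auto
    then obtain q where q: "i + j = l * q" by blast
    have "q \<noteq> 0" using ij q by (intro notI) auto
    moreover have "l * q \<le> l * 2"
      using ij(1,2) unfolding q[symmetric] atLeastAtMost_iff by linarith
    then have "q \<le> 2" using l_pos by simp
    ultimately have "q = 1 \<or> q = 2" by auto
    then show ?thesis using ij q by auto
  qed
  have sum_l: "br (X i) (Y (l - i)) = scale ((-1) ^ (l - i) * \<alpha>) z" if "i \<le> l" for i
  proof -
    have "(-1) ^ i * (-1) ^ l = ((-1) ^ (l - i) :: 'f)"
      using that by (metis (no_types, lifting) le_add_diff_inverse left_minus_one_mult_self power_add)
    moreover have "(-1) ^ i * inverse (\<alpha> ^ l) * ((-1) ^ l * \<alpha> ^ l * \<alpha>) = (-1) ^ i * (-1) ^ l * \<alpha>"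
      using \<alpha> by (simp add: field_simps)
    moreover have "br (X i) (Y (l - i))
        = scale ((-1) ^ i * inverse (\<alpha> ^ l) * ((-1) ^ l * \<alpha> ^ l * \<alpha>)) z"
      using that XY[of i "l - i"] y0(4) xy0 by (simp add: br_scale_right mult.assoc)
    ultimately show ?thesis by simp
  qed
  have ll: "br (X l) (Y l) = scale ((-1) ^ l * \<alpha>) z"
  proof -
    have "T (l + l) y0 = scale (\<alpha> ^ (l + l)) y0"
      using T_eigenvector[OF y0(4), of 2] by (simp add: power_mult_distrib power2_eq_square
        mult_2 power_add flip: power_mult)
    then show ?thesis
      using XY[of l l] \<alpha> xy0 by (simp add: br_scale_right)
  qed
  have Xl: "X l = x" and Yl: "Y l = scale ((-1) ^ l) y0"
    using chain_period[OF \<alpha>, of x 1] chain_period[OF \<alpha> y0(4)] x(3) unfolding X_def Y_def by simp_all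
  have XX: "br (X i) (X j) = 0" "br (Y i) (Y j) = 0" for i j
    unfolding X_def Y_def using chain_br W y0 iso iso0 by simp_all
  have ends: "br u (X l) = scale \<alpha> (X 1)" "br u (Y l) = scale ((-1) ^ l * \<alpha>) (Y 1)"
    unfolding Xl Yl using \<alpha> by (simp_all add: X_def Y_def chain_def br_scale_right)
  have steps: "\<forall>i\<in>{1..<l}. br u (X i) = scale \<alpha> (X (i + 1))"
    "\<forall>i\<in>{1..<l}. br u (Y i) = scale \<alpha> (Y (i + 1))"
    unfolding X_def Y_def using chain_step[OF \<alpha>] by simp_all
  have brackets: "\<forall>i\<in>{1..<l}. br (X i) (Y (l - i)) = scale ((-1) ^ (l - i) * \<alpha>) z"
    "\<forall>i\<in>{1..l}. \<forall>j\<in>{1..l}. br (X i) (X j) = 0" "\<forall>i\<in>{1..l}. \<forall>j\<in>{1..l}. br (Y i) (Y j) = 0"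
    using sum_l XX by simp_all
  have zero: "\<forall>i\<in>{1..l}. \<forall>j\<in>{1..l}. i + j \<noteq> l \<and> \<not> (i = l \<and> j = l) \<longrightarrow> br (X i) (Y j) = 0"
    using * by blast
  note paired = block_I_set_paired[OF z(1) \<alpha> brackets(1) ll brackets(2,3) zero]
  have "block_I z u \<alpha> l X Y"
    unfolding block_I_def block_I_set_def[symmetric]
    by (intro conjI l_pos \<alpha> paired_independent paired ends steps brackets zero ll)
  moreover have "X i \<in> S" "Y i \<in> S" "homogeneous \<Gamma> (X i)" "homogeneous \<Gamma> (Y i)" for i
    unfolding X_def Y_def using chain_invariant[OF S(1) S(3)] chain_homogeneous x y0 by blast+
  ultimately show ?thesis unfolding block_I_set_def by blast
qed

text \<open>
  Here a single chain pairs with itself. The assumption on the degree \<open>g\<close> makes the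
  exponents of \<open>ad u\<close> in a nonzero bracket add up to \<open>1\<close> modulo \<open>l\<close>, so inside the chain only the sum
  \<open>l + 1\<close> is possible. Scaling \<open>v\<close> by \<open>t\<close> multiplies \<open>[v, [u, v]]\<close> by \<open>t^2\<close>, which is why a square
  root normalises the block.
\<close>

lemma block_II_exists:
  assumes S: "subspace S" "S \<subseteq> W" "\<And>v. v \<in> S \<Longrightarrow> br u v \<in> S"
    and v: "v \<in> S" "v \<in> \<Gamma> g" "T l v = scale (\<alpha> ^ l) v"
    and \<alpha>: "\<alpha> \<noteq> 0" and l: "even l" and g: "g + (h + g) = d"
    and vv: "br v (br u v) \<noteq> 0"
  shows "\<exists>X. block_II z u \<alpha> (l div 2) X \<and> block_II_set (l div 2) X \<subseteq> S
    \<and> (\<forall>b\<in>block_II_set (l div 2) X. homogeneous \<Gamma> b)"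
proof -
  have W: "v \<in> W" using v S by blast
  obtain c where c: "br v (br u v) = scale c z" using br_W W ad_u_W by blast
  have "c \<noteq> 0" using c vv by auto
  obtain t where t: "t ^ 2 = \<alpha> ^ 2 / c" using nth_root_exists[of 2 "\<alpha> ^ 2 / c"] by auto
  define v0 where "v0 = scale t v"
  have v0: "v0 \<in> S" "v0 \<in> W" "v0 \<in> \<Gamma> g" "T l v0 = scale (\<alpha> ^ l) v0"
    using v W S grading_subspace[OF grading] subspace_scale
    unfolding v0_def by (auto simp: T_scale mult.commute span_scale)
  have "br v0 (br u v0) = scale (t ^ 2 * c) z"
    by (simp add: v0_def br_scale_left br_scale_right c power2_eq_square mult.assoc)
  then have vv0: "br v0 (br u v0) = scale (\<alpha> ^ 2) z" using t \<open>c \<noteq> 0\<close> by simp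
  define X where "X = chain \<alpha> v0"
  have XX: "br (X i) (X j) = scale ((-1) ^ i * inverse (\<alpha> ^ (i + j))) (br v0 (T (i + j) v0))" for i j
    unfolding X_def using chain_br v0 by blast
  have l2: "2 * (l div 2) = l" "l div 2 \<ge> 1" using l l_pos by auto
  have *: "i + j = l + 1" if ij: "i \<in> {1..l}" "j \<in> {1..l}" "br (X i) (X j) \<noteq> 0" for i j
  proof -
    obtain n where n: "i + j = Suc n" using ij by (cases "i + j") auto
    have "br v0 (T (Suc n) v0) \<noteq> 0" using XX[of i j] ij(3) n by auto
    then have "g + (multiple (Suc n) h + g) = d"
      using br_degree[OF v0(2) T_W[OF v0(2)] v0(3) T_degree[OF v0(3)]] by blast
    then have "g + (h + g) = g + ((h + multiple n h) + g)" using g by simp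
    then have "multiple n h = 0" by (metis add.assoc add.left_cancel add_cancel_right_left)
    then have "l dvd n" by (simp add: multiple_eq_0_iff)
    then obtain q where q: "n = l * q" by blast
    have "q \<noteq> 0" using ij q n by (intro notI) auto
    moreover have "l * q < l * 2"
      using ij(1,2) n unfolding q[symmetric] atLeastAtMost_iff by linarith
    then have "q < 2" by simp
    ultimately have "q = 1" by simp
    then show ?thesis using n q by simp
  qed
  have sum_l: "br (X i) (X (l - i + 1)) = scale ((-1) ^ i * \<alpha>) z" if "i \<in> {1..l}" for i
  proof -
    have i: "i + (l - i + 1) = Suc l" using that by auto
    have "T (Suc l) v0 = scale (\<alpha> ^ l) (br u v0)" using v0(4) by (simp add: br_scale_right)
    then have "br (X i) (X (l - i + 1))
        = scale ((-1) ^ i * (inverse (\<alpha> ^ Suc l) * (\<alpha> ^ l * \<alpha> ^ 2))) z"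
      unfolding XX i using vv0 by (simp add: br_scale_right mult.assoc del: power_Suc funpow.simps)
    moreover have "inverse (\<alpha> ^ Suc l) * (\<alpha> ^ l * \<alpha> ^ 2) = \<alpha>"
      using \<alpha> by (simp add: field_simps power2_eq_square)
    ultimately show ?thesis by simp
  qed
  have Xl: "X l = v0" using chain_period[OF \<alpha>, of v0 1] v0(4) unfolding X_def by simp
  have ends: "br u (X l) = scale \<alpha> (X 1)"
    unfolding Xl using \<alpha> by (simp add: X_def chain_def)
  have steps: "\<forall>i\<in>{1..<l}. br u (X i) = scale \<alpha> (X (i + 1))"
    unfolding X_def using chain_step[OF \<alpha>] by simp
  have brackets: "\<forall>i\<in>{1..l}. br (X i) (X (l - i + 1)) = scale ((-1) ^ i * \<alpha>) z"
    using sum_l by blast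
  have zero: "\<forall>i\<in>{1..l}. \<forall>j\<in>{1..l}. i + j \<noteq> l + 1 \<longrightarrow> br (X i) (X j) = 0"
    using * by blast
  note paired = block_II_set_paired[OF z(1) \<alpha>, of "l div 2" X, unfolded l2, OF brackets zero]
  have "block_II z u \<alpha> (l div 2) X"
    unfolding block_II_def block_II_set_def[symmetric] unfolding l2(1)
    by (intro conjI l2(2) \<alpha> paired_independent paired ends steps brackets zero)
  moreover have "X i \<in> S" "homogeneous \<Gamma> (X i)" for i
    unfolding X_def using chain_invariant[OF S(1) S(3)] chain_homogeneous v0 by blast+
  ultimately show ?thesis unfolding block_II_set_def by blast
qed

section \<open>A block in every nonzero complement\<close>

lemma multiple_inverse: "multiple ((l - 1) * n) h = - multiple n h"
proof -
  have "(l - 1) * n + n = n * l" using l_pos by (cases l) auto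
  then have "multiple ((l - 1) * n) h + multiple n h = 0"
    by (metis multiple_add multiple_eq_0_iff dvd_triv_right)
  then show ?thesis by (simp add: eq_neg_iff_add_eq_0)
qed

text \<open>
  By degree, \<open>T q v\<close> can only pair with \<open>v\<close> if \<open>l\<close> divides \<open>q\<close>, and then it is a multiple of \<open>v\<close>.
\<close>

lemma eigenvector_isotropic:
  assumes "v \<in> W" "v \<in> \<Gamma> p" "p + p = d" "T l v = scale c v"
  shows "br v (T q v) = 0"
proof (rule ccontr)
  assume "br v (T q v) \<noteq> 0"
  then have "p + (multiple q h + p) = d"
    using br_degree[OF assms(1) T_W[OF assms(1)] assms(2) T_degree[OF assms(2)]] by blast
  then have "multiple q h = 0" using assms(3) by (metis add.left_cancel add_cancel_left_left)
  then obtain n where "q = n * l" by (metis multiple_eq_0_iff dvd_def mult.commute)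
  then have "T q v = scale (c ^ n) v" using T_eigenvector[OF assms(4)] by simp
  then show False using \<open>br v (T q v) \<noteq> 0\<close> by (simp add: br_scale_right br_self)
qed

text \<open>A symmetric form that vanishes on \<open>x\<close>, \<open>y\<close> and \<open>x + y\<close> vanishes on the pair \<open>x\<close>, \<open>y\<close>.\<close>

lemma polarization:
  assumes "x \<in> W" "y \<in> W" "br x (br u y) \<noteq> 0"
  shows "\<exists>v\<in>{x, y, x + y}. br v (br u v) \<noteq> 0"
proof (rule ccontr)
  assume "\<not> ?thesis"
  then have 0: "br x (br u x) = 0" "br y (br u y) = 0" "br (x + y) (br u (x + y)) = 0"
    by blast+
  have "br y (br u x) = br x (br u y)"
    using ad_u_skew[OF assms(1,2)] br_antisym[of y "br u x"] by simp
  then have "br x (br u y) + br x (br u y) = 0"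
    using 0 by (simp add: br_add_left br_add_right)
  then have "scale 2 (br x (br u y)) = 0"
    by (metis one_add_one scale_left_distrib scale_one)
  then show False using assms(3) by simp
qed

text \<open>
  If the degrees of \<open>x\<close> and \<open>y\<close> differ by no multiple of \<open>h\<close>, neither chain can pair with itself and
  the two form a block of type I. If they differ by \<open>m h\<close>, moving \<open>y\<close> back along its
  chain into the degree \<open>g\<close> gives \<open>d = 2 g + m h\<close>. Moving both vectors forward by half of \<open>m\<close>
  leads to a degree \<open>p\<close> with \<open>d = 2 p\<close> for even \<open>m\<close> and \<open>d = 2 p + h\<close> for odd \<open>m\<close>. As \<open>m\<close> only matters modulo
  \<open>l\<close>, the second case is left for even \<open>l\<close> only; there \<open>(-1)^l = 1\<close> puts both vectors
  into one eigenspace, on which polarisation provides the vector for a block of type II.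
\<close>

lemma block_from_pair:
  assumes S: "subspace S" "S \<subseteq> W" "\<And>v. v \<in> S \<Longrightarrow> br u v \<in> S"
    and x: "x \<in> S" "x \<in> \<Gamma> g" "T l x = scale (\<alpha> ^ l) x"
    and y: "y \<in> S" "y \<in> \<Gamma> g'" "T l y = scale ((-1) ^ l * \<alpha> ^ l) y"
    and \<alpha>: "\<alpha> \<noteq> 0" and xy: "br x y \<noteq> 0"
  shows "(\<exists>X Y. block_I z u \<alpha> l X Y \<and> block_I_set l X Y \<subseteq> S
      \<and> (\<forall>b\<in>block_I_set l X Y. homogeneous \<Gamma> b))
    \<or> even l \<and> (\<exists>X. block_II z u \<alpha> (l div 2) X \<and> block_II_set (l div 2) X \<subseteq> S
      \<and> (\<forall>b\<in>block_II_set (l div 2) X. homogeneous \<Gamma> b))"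
proof -
  have W: "x \<in> W" "y \<in> W" using x y S by blast+
  have d: "g + g' = d" using br_degree[OF W x(2) y(2) xy] .
  define c where "c = (-1) ^ l * \<alpha> ^ l"
  have "c \<noteq> 0" using \<alpha> by (simp add: c_def)
  show ?thesis
  proof (cases "\<exists>m. g' = multiple m h + g")
    case False
    have "br x (T n x) = 0" for n
    proof (rule ccontr)
      assume "br x (T n x) \<noteq> 0"
      then have "g + (multiple n h + g) = g + g'"
        using br_degree[OF W(1) T_W[OF W(1)] x(2) T_degree[OF x(2)]] d by blast
      then show False using False by auto
    qed
    moreover have "br y (T n y) = 0" for n
    proof (rule ccontr)
      assume "br y (T n y) \<noteq> 0"
      then have "g' + (multiple n h + g') = g + g'"
        using br_degree[OF W(2) T_W[OF W(2)] y(2) T_degree[OF y(2)]] d by blast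
      then have "g' = multiple ((l - 1) * n) h + g"
        unfolding multiple_inverse by (simp add: algebra_simps)
      then show False using False by blast
    qed
    ultimately show ?thesis using block_I_exists[OF S x y \<alpha> xy] by blast
  next
    case True
    then obtain m where m: "g' = multiple m h + g" by blast
    \<comment> \<open>As \<open>l h = 0\<close>, raising the degree by \<open>(l - 1) m h\<close> lowers it by \<open>m h\<close>.\<close>
    define y1 where "y1 = T ((l - 1) * m) y"
    have y1: "y1 \<in> S" "y1 \<in> \<Gamma> g"
      using T_invariant[OF S(3) y(1)] T_degree[OF y(2), of "(l - 1) * m"] m
      unfolding y1_def multiple_inverse by (simp_all add: add.assoc[symmetric])
    have "m + (l - 1) * m = m * l" using l_pos by (cases l) auto
    then have "T m y1 = scale (c ^ m) y"
      unfolding y1_def T_T using T_eigenvector[OF y(3)] c_def by simp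
    then have xy1: "br x (T m y1) \<noteq> 0" using xy \<open>c \<noteq> 0\<close> by (simp add: br_scale_right)
    have commute: "T l (T n v) = scale a (T n v)" if "T l v = scale a v" for n v a
      using that T_T[of l n v] T_T[of n l v] by (simp add: add.commute T_scale)
    have y1l: "T l y1 = scale c y1" unfolding y1_def c_def using commute[OF y(3)] .
    have inv: "T n x \<in> S" "T n y1 \<in> S" "T n x \<in> \<Gamma> (multiple n h + g)" "T n y1 \<in> \<Gamma> (multiple n h + g)"
      "T l (T n x) = scale (\<alpha> ^ l) (T n x)" "T l (T n y1) = scale c (T n y1)" for n
      using T_invariant[OF S(3)] T_degree x y1 y1l commute by blast+
    show ?thesis
    proof (cases "even m \<or> odd l")
      case True
      have "\<exists>n. multiple (n + n) h = multiple m h \<and> br x (T (n + n) y1) \<noteq> 0"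
      proof (cases "even m")
        case True
        then obtain n where "m = n + n" by (metis evenE mult_2)
        then show ?thesis using xy1 by blast
      next
        case False
        then have "even (m + l)" using True by simp
        then obtain n where n: "m + l = n + n" by (metis evenE mult_2)
        have "T (m + l) y1 = scale c (T m y1)" using T_T[of m l y1] y1l by (simp add: T_scale)
        then have "br x (T (m + l) y1) \<noteq> 0" using xy1 \<open>c \<noteq> 0\<close> by (simp add: br_scale_right)
        then show ?thesis using n multiple_add[of m l h] multiple_l by (metis add.right_neutral)
      qed
      then obtain n where n: "multiple (n + n) h = multiple m h" "br x (T (n + n) y1) \<noteq> 0"
        by blast
      define p where "p = multiple n h + g"
      have "p + p = d" using n(1) d m unfolding p_def multiple_add by (simp add: algebra_simps)
      moreover have "br (T n x) (T n y1) \<noteq> 0"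
        using n(2) T_skew[OF W(1), of "T n y1" n] inv(2)[of n] S(2) by (auto simp: T_T)
      ultimately show ?thesis
        using block_I_exists[OF S inv(1,3,5)[of n] inv(2,4,6)[of n, unfolded c_def] \<alpha>]
          eigenvector_isotropic[of "T n x" p] eigenvector_isotropic[of "T n y1" p] inv S(2)
        unfolding p_def by blast
    next
      case False
      then obtain n where n: "m = Suc (n + n)" by (metis oddE mult_2 Suc_eq_plus1)
      have l: "even l" "c = \<alpha> ^ l" using False by (auto simp: c_def)
      define p where "p = multiple n h + g"
      have "multiple m h = h + (multiple n h + multiple n h)" by (simp add: n multiple_add)
      then have p: "p + (h + p) = d" using d m unfolding p_def by (simp add: algebra_simps)
      have "br (T n x) (br u (T n y1)) = scale ((-1) ^ n) (br x (T n (br u (T n y1))))"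
        using T_skew[of x "br u (T n y1)" n] inv(2) S W by blast
      also have "T n (br u (T n y1)) = T m y1"
        using T_T[of n "Suc n" y1] n by simp
      finally have "br (T n x) (br u (T n y1)) \<noteq> 0" using xy1 by simp
      then obtain v where v: "v \<in> {T n x, T n y1, T n x + T n y1}" "br v (br u v) \<noteq> 0"
        using polarization[OF subsetD[OF S(2) inv(1)] subsetD[OF S(2) inv(2)]] by blast
      have "T n x + T n y1 \<in> S" "T n x + T n y1 \<in> \<Gamma> p"
        "T l (T n x + T n y1) = scale (\<alpha> ^ l) (T n x + T n y1)"
        using inv[of n] S(1) grading_subspace[OF grading] subspace_add l
        unfolding p_def by (auto simp: T_add scale_right_distrib)
      then have "v \<in> S \<and> v \<in> \<Gamma> p \<and> T l v = scale (\<alpha> ^ l) v"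
        using v(1) inv[of n] l(2) unfolding p_def by blast
      then show ?thesis
        using block_II_exists[OF S _ _ _ \<alpha> l(1) p v(2)] l(1) by blast
    qed
  qed
qed

text \<open>
  Projecting homogeneous vectors to the complement yields homogeneous \<open>x'\<close>, \<open>y'\<close> there that are not
  orthogonal. They are replaced by eigenvectors of \<open>T l\<close> in their degrees, one after the other, keeping
  the bracket nonzero; by skew-symmetry the two eigenvalues then agree up to the sign
  \<open>(-1)^l\<close>.
\<close>

lemma block_in_complement:
  assumes B: "paired B" "finite B" "B \<subseteq> W" "\<forall>b\<in>B. homogeneous \<Gamma> b"
    and T_B: "\<And>b. b \<in> B \<Longrightarrow> br u b \<in> span B" and not: "\<not> W \<subseteq> span B"
  shows "\<exists>\<alpha>\<in>\<Lambda>. (\<exists>X Y. block_I z u \<alpha> l X Y \<and> block_I_set l X Y \<subseteq> orth B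
      \<and> (\<forall>b\<in>block_I_set l X Y. homogeneous \<Gamma> b))
    \<or> even l \<and> (\<exists>X. block_II z u \<alpha> (l div 2) X \<and> block_II_set (l div 2) X \<subseteq> orth B
      \<and> (\<forall>b\<in>block_II_set (l div 2) X. homogeneous \<Gamma> b))"
proof -
  have orth_B: "br v b = 0" if "v \<in> orth B" "b \<in> span B" for v b
    using that br_span_eq_0_right unfolding orth_def by blast
  have inv: "br u v \<in> orth B" if "v \<in> orth B" for v
  proof -
    have "v \<in> W" using that orth_W by blast
    have "br (br u v) b = 0" if "b \<in> B" for b
      using ad_u_skew[OF \<open>v \<in> W\<close>, of b] orth_B[OF \<open>v \<in> orth B\<close> T_B[OF that]] that B(3) by auto
    then show ?thesis using \<open>v \<in> W\<close> ad_u_W unfolding orth_def by blast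
  qed
  have "\<not> {x \<in> W. homogeneous \<Gamma> x} \<subseteq> span B"
    using not F_graded span_minimal[OF _ subspace_span] by blast
  then obtain m g where m: "m \<in> W" "m \<in> \<Gamma> g" "m \<notin> span B"
    unfolding homogeneous_def by blast
  then obtain x' where x': "x' \<in> orth B" "x' \<in> \<Gamma> g" "m - x' \<in> span B"
    using orth_projection[OF B] by blast
  have "x' \<noteq> 0" using x'(3) m(3) by auto
  then obtain w where w: "w \<in> W" "br x' w \<noteq> 0" using W_nondegenerate x'(1) orth_W by blast
  then obtain y'' where y'': "y'' \<in> W" "homogeneous \<Gamma> y''" "br x' y'' \<noteq> 0"
    using br_span_eq_0_right[of w "{x \<in> W. homogeneous \<Gamma> x}" x'] F_graded by blast
  then obtain g' where "y'' \<in> \<Gamma> g'" unfolding homogeneous_def by blast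
  then obtain y' where y': "y' \<in> orth B" "y' \<in> \<Gamma> g'" "y'' - y' \<in> span B"
    using orth_projection[OF B y''(1)] by blast
  have "br x' y' \<noteq> 0" using orth_B[OF x'(1) y'(3)] y''(3) by (simp add: br_diff_right)
  then have yx': "br y' x' \<noteq> 0" using br_eq_0_commute by blast
  have N: "subspace (orth B \<inter> \<Gamma> a)" "orth B \<inter> \<Gamma> a \<subseteq> W"
    "\<And>v. v \<in> orth B \<inter> \<Gamma> a \<Longrightarrow> T l v \<in> orth B \<inter> \<Gamma> a" for a
    using subspace_inter[OF orth_subspace grading_subspace[OF grading]] orth_W
      T_invariant[of "orth B", OF inv] T_degree[of _ a l] multiple_l by auto
  obtain x \<mu> where x: "x \<in> orth B \<inter> \<Gamma> g" "\<mu> \<in> \<Lambda>" "T l x = scale (\<mu> ^ l) x" "br y' x \<noteq> 0"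
    using paired_eigenvector[OF N _ yx'] x' by blast
  have xy': "br x y' \<noteq> 0" using x(4) br_eq_0_commute by blast
  obtain y \<mu>' where y: "y \<in> orth B \<inter> \<Gamma> g'" "T l y = scale (\<mu>' ^ l) y" "br x y \<noteq> 0"
    using paired_eigenvector[OF N _ xy'] y' by blast
  have W: "x \<in> W" "y \<in> W" using x y orth_W by blast+
  have "scale (\<mu> ^ l) (br x y) = scale ((-1) ^ l * \<mu>' ^ l) (br x y)"
    using T_skew[OF W, of l] x(3) y(2) by (simp add: br_scale_left br_scale_right)
  then have "\<mu> ^ l = (-1) ^ l * \<mu>' ^ l" using y(3) by simp
  then have "\<mu>' ^ l = (-1) ^ l * \<mu> ^ l" by (simp add: left_minus_one_mult_self)
  then have "T l y = scale ((-1) ^ l * \<mu> ^ l) y" using y(2) by simp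
  moreover have "\<mu> \<noteq> 0" using x(2) eigenvalue_nonzero by blast
  ultimately show ?thesis
    using block_from_pair[OF orth_subspace orth_W inv _ _ x(3) _ _ _ _ y(3)] x y by blast
qed

end

section \<open>Maximal families of blocks\<close>

context graded_heisenberg
begin

definition family_set ::
    "nat \<Rightarrow> nat \<Rightarrow> (nat \<Rightarrow> nat \<Rightarrow> 'v) \<Rightarrow> (nat \<Rightarrow> nat \<Rightarrow> 'v) \<Rightarrow> (nat \<Rightarrow> nat \<Rightarrow> 'v) \<Rightarrow> 'v set" where
  "family_set s r x y w =
    (\<Union>j\<in>{1..s}. block_I_set l (x j) (y j)) \<union> (\<Union>i\<in>{1..r}. block_II_set (l div 2) (w i))"

definition block_family ::
    "nat \<Rightarrow> nat \<Rightarrow> (nat \<Rightarrow> 'f) \<Rightarrow> (nat \<Rightarrow> 'f) \<Rightarrow>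
     (nat \<Rightarrow> nat \<Rightarrow> 'v) \<Rightarrow> (nat \<Rightarrow> nat \<Rightarrow> 'v) \<Rightarrow> (nat \<Rightarrow> nat \<Rightarrow> 'v) \<Rightarrow> bool" where
  "block_family s r \<beta> \<alpha> x y w \<longleftrightarrow>
     (odd l \<longrightarrow> r = 0) \<and>
     (\<forall>j\<in>{1..s}. \<beta> j \<in> \<Lambda>) \<and> (\<forall>i\<in>{1..r}. \<alpha> i \<in> \<Lambda>) \<and>
     (\<forall>j\<in>{1..s}. block_I z u (\<beta> j) l (x j) (y j)) \<and>
     (\<forall>i\<in>{1..r}. block_II z u (\<alpha> i) (l div 2) (w i)) \<and>
     (\<forall>j\<in>{1..s}. \<forall>j'\<in>{1..s}. j \<noteq> j' \<longrightarrow>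
        brackets_vanish (block_I_set l (x j) (y j)) (block_I_set l (x j') (y j'))) \<and>
     (\<forall>i\<in>{1..r}. \<forall>i'\<in>{1..r}. i \<noteq> i' \<longrightarrow>
        brackets_vanish (block_II_set (l div 2) (w i)) (block_II_set (l div 2) (w i'))) \<and>
     (\<forall>j\<in>{1..s}. \<forall>i\<in>{1..r}.
        brackets_vanish (block_I_set l (x j) (y j)) (block_II_set (l div 2) (w i))) \<and>
     family_set s r x y w \<subseteq> W \<and> (\<forall>b\<in>family_set s r x y w. homogeneous \<Gamma> b)"

lemma block_family_properties:
  assumes "block_family s r \<beta> \<alpha> x y w"
  shows "paired (family_set s r x y w)" "finite (family_set s r x y w)"
    "card (family_set s r x y w) = l * (r + 2 * s)"
    "b \<in> family_set s r x y w \<Longrightarrow> br u b \<in> span (family_set s r x y w)"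
proof -
  let ?I = "\<lambda>j. block_I_set l (x j) (y j)" and ?II = "\<lambda>i. block_II_set (l div 2) (w i)"
  have odd: "odd l \<longrightarrow> r = 0" and I: "\<And>j. j \<in> {1..s} \<Longrightarrow> block_I z u (\<beta> j) l (x j) (y j)"
    and II: "\<And>i. i \<in> {1..r} \<Longrightarrow> block_II z u (\<alpha> i) (l div 2) (w i)"
    and vI: "\<And>i j. i \<in> {1..s} \<Longrightarrow> j \<in> {1..s} \<Longrightarrow> i \<noteq> j \<Longrightarrow> brackets_vanish (?I i) (?I j)"
    and vII: "\<And>i j. i \<in> {1..r} \<Longrightarrow> j \<in> {1..r} \<Longrightarrow> i \<noteq> j \<Longrightarrow> brackets_vanish (?II i) (?II j)"
    and v: "\<And>j i. j \<in> {1..s} \<Longrightarrow> i \<in> {1..r} \<Longrightarrow> brackets_vanish (?I j) (?II i)"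
    using assms unfolding block_family_def by blast+
  have fin: "finite (?I j)" "finite (?II i)" for i j
    unfolding block_I_set_def block_II_set_def by simp_all
  have UI: "paired (\<Union>j\<in>{1..s}. ?I j)" "card (\<Union>j\<in>{1..s}. ?I j) = card {1..s} * (2 * l)"
    using paired_UN[of "{1..s}" ?I "2 * l"] vI fin block_I_paired[OF I z(1)] by simp_all
  have UII: "paired (\<Union>i\<in>{1..r}. ?II i)" "card (\<Union>i\<in>{1..r}. ?II i) = card {1..r} * (2 * (l div 2))"
    using paired_UN[of "{1..r}" ?II "2 * (l div 2)"] vII fin block_II_paired[OF II z(1)] by simp_all
  have "brackets_vanish (\<Union>j\<in>{1..s}. ?I j) (\<Union>i\<in>{1..r}. ?II i)"
    using v unfolding brackets_vanish_def by blast
  note U = paired_Un[OF UI(1) UII(1) this]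
  show "paired (family_set s r x y w)" using U(1) unfolding family_set_def .
  show "finite (family_set s r x y w)" unfolding family_set_def using fin by blast
  have "card (family_set s r x y w) = s * (2 * l) + r * (2 * (l div 2))"
    unfolding family_set_def using U(2) UI(2) UII(2) fin by (subst card_Un_disjoint) auto
  also have "\<dots> = l * (r + 2 * s)"
    using odd by (cases "odd l") (auto simp: algebra_simps)
  finally show "card (family_set s r x y w) = l * (r + 2 * s)" .
  assume "b \<in> family_set s r x y w"
  then consider j where "j \<in> {1..s}" "b \<in> ?I j" | i where "i \<in> {1..r}" "b \<in> ?II i"
    unfolding family_set_def by blast
  then show "br u b \<in> span (family_set s r x y w)"
  proof cases
    case 1
    then have "br u b \<in> span (?I j)" using block_I_invariant I by blast
    moreover have "?I j \<subseteq> family_set s r x y w" using 1 unfolding family_set_def by blast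
    ultimately show ?thesis using span_mono by blast
  next
    case 2
    then have "br u b \<in> span (?II i)" using block_II_invariant II by blast
    moreover have "?II i \<subseteq> family_set s r x y w" using 2 unfolding family_set_def by blast
    ultimately show ?thesis using span_mono by blast
  qed
qed

lemma orth_brackets_vanish: "A \<subseteq> orth B \<Longrightarrow> C \<subseteq> B \<Longrightarrow> brackets_vanish A C"
  unfolding orth_def brackets_vanish_def by blast

lemma add_block_I:
  assumes fam: "block_family s r \<beta> \<alpha> x y w" and a: "a \<in> \<Lambda>" "block_I z u a l X Y"
    and B: "block_I_set l X Y \<subseteq> orth (family_set s r x y w)"
      "\<forall>b\<in>block_I_set l X Y. homogeneous \<Gamma> b"
  shows "block_family (Suc s) r (\<beta>(Suc s := a)) \<alpha> (x(Suc s := X)) (y(Suc s := Y)) w"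
proof -
  have new: "{1..Suc s} = insert (Suc s) {1..s}" by auto
  have old: "j \<noteq> Suc s" if "j \<in> {1..s}" for j using that by auto
  have set: "family_set (Suc s) r (x(Suc s := X)) (y(Suc s := Y)) w
      = block_I_set l X Y \<union> family_set s r x y w"
    unfolding family_set_def new using old by auto
  have v: "brackets_vanish (block_I_set l X Y) (block_I_set l (x j) (y j))"
    "brackets_vanish (block_I_set l (x j) (y j)) (block_I_set l X Y)" if "j \<in> {1..s}" for j
  proof -
    show "brackets_vanish (block_I_set l X Y) (block_I_set l (x j) (y j))"
      by (rule orth_brackets_vanish[OF B(1)]) (use that in \<open>auto simp: family_set_def\<close>)
    then show "brackets_vanish (block_I_set l (x j) (y j)) (block_I_set l X Y)"
      using brackets_vanish_commute by blast
  qed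
  have v': "brackets_vanish (block_I_set l X Y) (block_II_set (l div 2) (w i))" if "i \<in> {1..r}" for i
    by (rule orth_brackets_vanish[OF B(1)]) (use that in \<open>auto simp: family_set_def\<close>)
  have "block_I_set l X Y \<subseteq> W" using B(1) orth_W by blast
  then show ?thesis
    using fam a B(2) v v' old unfolding block_family_def set unfolding new
    by (simp add: ball_Un del: One_nat_def atLeastAtMost_iff)
qed

lemma add_block_II:
  assumes fam: "block_family s r \<beta> \<alpha> x y w" and a: "a \<in> \<Lambda>" "block_II z u a (l div 2) X"
    and l: "even l"
    and B: "block_II_set (l div 2) X \<subseteq> orth (family_set s r x y w)"
      "\<forall>b\<in>block_II_set (l div 2) X. homogeneous \<Gamma> b"
  shows "block_family s (Suc r) \<beta> (\<alpha>(Suc r := a)) x y (w(Suc r := X))"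
proof -
  have new: "{1..Suc r} = insert (Suc r) {1..r}" by auto
  have old: "j \<noteq> Suc r" if "j \<in> {1..r}" for j using that by auto
  have set: "family_set s (Suc r) x y (w(Suc r := X))
      = block_II_set (l div 2) X \<union> family_set s r x y w"
    unfolding family_set_def new using old by auto
  have v: "brackets_vanish (block_II_set (l div 2) X) (block_II_set (l div 2) (w j))"
    "brackets_vanish (block_II_set (l div 2) (w j)) (block_II_set (l div 2) X)" if "j \<in> {1..r}" for j
  proof -
    show "brackets_vanish (block_II_set (l div 2) X) (block_II_set (l div 2) (w j))"
      by (rule orth_brackets_vanish[OF B(1)]) (use that in \<open>auto simp: family_set_def\<close>)
    then show "brackets_vanish (block_II_set (l div 2) (w j)) (block_II_set (l div 2) X)"
      using brackets_vanish_commute by blast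
  qed
  have v': "brackets_vanish (block_I_set l (x i) (y i)) (block_II_set (l div 2) X)" if "i \<in> {1..s}" for i
  proof -
    have "brackets_vanish (block_II_set (l div 2) X) (block_I_set l (x i) (y i))"
      by (rule orth_brackets_vanish[OF B(1)]) (use that in \<open>auto simp: family_set_def\<close>)
    then show ?thesis using brackets_vanish_commute by blast
  qed
  have "block_II_set (l div 2) X \<subseteq> W" using B(1) orth_W by blast
  then show ?thesis
    using fam a l B(2) v v' old unfolding block_family_def set unfolding new
    by (simp add: ball_Un del: One_nat_def atLeastAtMost_iff)
qed

text \<open>
  The number \<open>r + 2 s\<close> is bounded because blocks are independent, and it grows whenever the
  complement of a family is not zero. So a family that maximises it spans \<open>W\<close>.
\<close>

theorem spanning_block_family:
  "\<exists>s r \<beta> \<alpha> x y w. block_family s r \<beta> \<alpha> x y w \<and> span (family_set s r x y w) = W"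
proof -
  define P where "P N \<longleftrightarrow> (\<exists>s r \<beta> \<alpha> x y w. block_family s r \<beta> \<alpha> x y w \<and> N = r + 2 * s)" for N
  have "block_family 0 0 \<beta> \<alpha> x y w" for \<beta> \<alpha> x y w
    unfolding block_family_def family_set_def by simp
  then have P0: "P 0" unfolding P_def by fastforce
  have bound: "N < Suc (card F)" if N: "P N" for N
  proof -
    obtain s r \<beta> \<alpha> x y w where fam: "block_family s r \<beta> \<alpha> x y w" and N: "N = r + 2 * s"
      using N unfolding P_def by blast
    have "card (family_set s r x y w) \<le> card F"
      using independent_span_bound[OF F(1) paired_independent[OF block_family_properties(1)[OF fam]]]
        fam unfolding block_family_def by blast
    then have "l * N \<le> card F" using block_family_properties(3)[OF fam] N by simp
    moreover have "N \<le> l * N" using l_pos by (cases l) auto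
    ultimately show ?thesis by linarith
  qed
  obtain N where N: "P N" "\<And>M. P M \<Longrightarrow> M \<le> N"
    using ex_has_greatest_nat[of P 0 "\<lambda>n. n" "Suc (card F)"] P0 bound by blast
  obtain s r \<beta> \<alpha> x y w where fam: "block_family s r \<beta> \<alpha> x y w" and Nrs: "N = r + 2 * s"
    using N(1) unfolding P_def by blast
  let ?B = "family_set s r x y w"
  have BW: "?B \<subseteq> W" "\<forall>b\<in>?B. homogeneous \<Gamma> b" using fam unfolding block_family_def by blast+
  note B = block_family_properties[OF fam]
  have "W \<subseteq> span ?B"
  proof (rule ccontr)
    assume "\<not> W \<subseteq> span ?B"
    from block_in_complement[OF B(1,2) BW B(4) this]
    obtain a where a: "a \<in> \<Lambda>" and cases:
      "(\<exists>X Y. block_I z u a l X Y \<and> block_I_set l X Y \<subseteq> orth ?B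
          \<and> (\<forall>b\<in>block_I_set l X Y. homogeneous \<Gamma> b))
        \<or> even l \<and> (\<exists>X. block_II z u a (l div 2) X \<and> block_II_set (l div 2) X \<subseteq> orth ?B
          \<and> (\<forall>b\<in>block_II_set (l div 2) X. homogeneous \<Gamma> b))"
      by blast
    from cases have "P (r + 2 * Suc s) \<or> P (Suc r + 2 * s)"
    proof (elim disjE exE conjE)
      fix X Y assume "block_I z u a l X Y" "block_I_set l X Y \<subseteq> orth ?B"
        "\<forall>b\<in>block_I_set l X Y. homogeneous \<Gamma> b"
      from add_block_I[OF fam a this] show ?thesis unfolding P_def by blast
    next
      fix X assume "even l" "block_II z u a (l div 2) X" "block_II_set (l div 2) X \<subseteq> orth ?B"
        "\<forall>b\<in>block_II_set (l div 2) X. homogeneous \<Gamma> b"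
      from add_block_II[OF fam a this(2,1,3,4)] show ?thesis unfolding P_def by blast
    qed
    then show False using N(2)[of "r + 2 * Suc s"] N(2)[of "Suc r + 2 * s"] Nrs by auto
  qed
  then have "span ?B = W" using BW span_minimal[OF _ subspace_span] by blast
  then show ?thesis using fam by blast
qed

end

section \<open>The twisted Heisenberg algebra\<close>

context twisted_heisenberg
begin

abbreviation E :: "'v set" where
  "E \<equiv> e ` {1..k} \<union> e' ` {1..k}"

lemma basis_set: "{z0, u0} \<union> e ` {1..k} \<union> e' ` {1..k} = insert u0 (insert z0 E)"
  by auto

lemma span_basis: "x \<in> span (insert u0 (insert z0 E))"
  using basis unfolding is_basis_def basis_set by simp

lemma z0_nonzero: "z0 \<noteq> 0"
  using basis dependent_zero unfolding is_basis_def by auto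

lemma z0_central: "br z0 x = 0"
  by (rule br_span_eq_0_right[OF span_basis]) (auto simp: br_z_u br_z_e br_z_e' br_self)

lemma z0_central': "br x z0 = 0"
  using z0_central br_eq_0_commute by blast

lemma br_e_e'_cases:
  assumes "i \<in> {1..k}" "j \<in> {1..k}"
  shows "br (e i) (e' j) = scale (if i = j then lam i else 0) z0"
    "br (e' i) (e j) = scale (if i = j then - lam i else 0) z0"
proof -
  have *: "br (e i) (e' j) = scale (if i = j then lam i else 0) z0" if "i \<in> {1..k}" "j \<in> {1..k}" for i j
    using that br_e_e'[of i] br_e_e'_distinct[of i j] by (cases "i = j") auto
  show "br (e' i) (e j) = scale (if i = j then - lam i else 0) z0"
    using br_antisym[of "e' i" "e j"] *[OF assms(2,1)] by (cases "i = j") auto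
  show "br (e i) (e' j) = scale (if i = j then lam i else 0) z0"
    using *[OF assms] .
qed

lemma br_E:
  assumes "a \<in> E" "b \<in> E"
  shows "br a b \<in> span {z0}"
proof -
  obtain i where i: "i \<in> {1..k}" "a = e i \<or> a = e' i" using assms(1) by blast
  obtain j where j: "j \<in> {1..k}" "b = e j \<or> b = e' j" using assms(2) by blast
  have "br (e i) (e' j) \<in> span {z0}" "br (e' i) (e j) \<in> span {z0}"
    unfolding br_e_e'_cases[OF i(1) j(1)] by (intro span_scale span_base singletonI)+
  moreover have "br (e i) (e j) \<in> span {z0}" "br (e' i) (e' j) \<in> span {z0}"
    unfolding br_e_e[OF i(1) j(1)] br_e'_e'[OF i(1) j(1)] by (rule span_zero)+
  ultimately show ?thesis using i(2) j(2) by blast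
qed

lemma br_nilradical:
  assumes "x \<in> span (insert z0 E)" "y \<in> span (insert z0 E)"
  shows "br x y \<in> span {z0}"
  by (intro br_in_subspace_left[OF assms(1)] br_in_subspace_right[OF assms(2)] subspace_span)
    (use br_E z0_central z0_central' span_zero in auto)

lemma e'_not_central:
  assumes "i \<in> {1..k}" "lam i \<noteq> 0"
  shows "e' i \<notin> span {z0}"
proof
  assume "e' i \<in> span {z0}"
  then have "br (e i) (e' i) = 0" using z0_central' br_span_eq_0_right by blast
  then show False using br_e_e'[OF assms(1)] assms(2) z0_nonzero by simp
qed

lemma u0_not_in_nilradical:
  assumes "i \<in> {1..k}" "lam i \<noteq> 0"
  shows "u0 \<notin> span (insert z0 E)"
proof
  assume u0: "u0 \<in> span (insert z0 E)"
  have "br u0 (e i) \<in> span {z0}"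
    using assms(1) by (intro br_nilradical u0 span_base) auto
  then have "scale (inverse (lam i)) (scale (lam i) (e' i)) \<in> span {z0}"
    using br_u_e[OF assms(1)] span_scale by metis
  then show False using e'_not_central[OF assms] assms(2) by simp
qed

lemma paired_E:
  assumes "\<forall>i\<in>{1..k}. lam i \<noteq> 0"
  shows "paired E"
proof -
  have ee': "br (e i) (e' j) \<noteq> 0 \<longleftrightarrow> j = i" "br (e' i) (e j) \<noteq> 0 \<longleftrightarrow> j = i"
    if "i \<in> {1..k}" "j \<in> {1..k}" for i j
    using br_e_e'_cases[OF that] that assms z0_nonzero by auto
  show ?thesis
    unfolding paired_def
  proof
    fix b assume "b \<in> E"
    then consider i where "i \<in> {1..k}" "b = e i" | i where "i \<in> {1..k}" "b = e' i" by blast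
    then show "\<exists>!c. c \<in> E \<and> br b c \<noteq> 0"
    proof cases
      case 1
      then show ?thesis
        using ee'(1)[of i] br_e_e[of i] by (intro ex1I[of _ "e' i"]) blast+
    next
      case 2
      then show ?thesis
        using ee'(2)[of i] br_e'_e'[of i] by (intro ex1I[of _ "e i"]) blast+
    qed
  qed
qed

text \<open>
  Bracketing a central element with \<open>e 1\<close> shows that it has no component along \<open>u0\<close>, and the
  form on the span of \<open>E\<close> is nondegenerate.
\<close>

lemma center_eq:
  assumes "k \<ge> 1" "\<forall>i\<in>{1..k}. lam i \<noteq> 0" "z \<in> center"
  shows "\<exists>c. z = scale c z0"
proof -
  have z: "br z x = 0" for x using assms(3) unfolding center_def by blast
  have 1: "1 \<in> {1..k}" "lam 1 \<noteq> 0" using assms by auto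
  obtain b where "z - scale b u0 \<in> span (insert z0 E)"
    using span_basis[of z] unfolding span_insert[of u0] by blast
  then obtain a where "z - scale b u0 - scale a z0 \<in> span E"
    unfolding span_insert[of z0] by blast
  then obtain v where v: "v \<in> span E" "z = scale b u0 + scale a z0 + v"
    by (metis add.commute diff_add_cancel diff_diff_add)
  have br_v: "br v p = - scale b (br u0 p)" for p
    using z[of p] unfolding v(2) by (simp add: br_add_left br_scale_left z0_central eq_neg_iff_add_eq_0 add.commute)
  have "br v (e 1) \<in> span {z0}"
    using v(1) 1 span_mono[of E "insert z0 E"] by (intro br_nilradical) (auto intro: span_base)
  then have "scale (- (b * lam 1)) (e' 1) \<in> span {z0}"
    using br_v[of "e 1"] br_u_e[OF 1(1)] by simp
  then have b: "scale (inverse (- (b * lam 1)) * - (b * lam 1)) (e' 1) \<in> span {z0}"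
    unfolding scale_scale[symmetric] using span_scale by blast
  have "b = 0"
  proof (rule ccontr)
    assume "b \<noteq> 0"
    then have "inverse (- (b * lam 1)) * - (b * lam 1) = 1" using 1(2) by (intro left_inverse) simp
    then show False using b e'_not_central[OF 1] by simp
  qed
  then have "br v p = 0" for p using br_v by simp
  then have "v = 0" using paired_nondegenerate[OF paired_E[OF assms(2)] v(1)] by blast
  then show ?thesis using v(2) \<open>b = 0\<close> by simp
qed

text \<open>
  A grading contains a homogeneous element outside the nilradical, and it can be scaled to \<open>u0\<close>
  plus an element of the nilradical.
\<close>

lemma homogeneous_derivation:
  assumes "k \<ge> 1" "\<forall>i\<in>{1..k}. lam i \<noteq> 0" "is_grading \<Gamma>"
  shows "\<exists>u. homogeneous \<Gamma> u \<and> u - u0 \<in> span (insert z0 E)"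
proof -
  have 1: "1 \<in> {1..k}" "lam 1 \<noteq> 0" using assms by auto
  have "\<not> {x. homogeneous \<Gamma> x} \<subseteq> span (insert z0 E)"
    using u0_not_in_nilradical[OF 1] grading_span_homogeneous[OF assms(3), of u0]
      span_minimal[OF _ subspace_span] by blast
  then obtain x g where x: "x \<in> \<Gamma> g" "x \<notin> span (insert z0 E)" unfolding homogeneous_def by blast
  obtain b where b: "x - scale b u0 \<in> span (insert z0 E)"
    using span_basis[of x] unfolding span_insert[of u0] by blast
  have "b \<noteq> 0" using b x(2) by auto
  have "scale (inverse b) (x - scale b u0) \<in> span (insert z0 E)"
    using b span_scale by blast
  then have "scale (inverse b) x - u0 \<in> span (insert z0 E)"
    using \<open>b \<noteq> 0\<close> by (simp add: scale_right_diff_distrib)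
  moreover have "homogeneous \<Gamma> (scale (inverse b) x)"
    using x(1) grading_subspace[OF assms(3)] subspace_scale unfolding homogeneous_def by blast
  ultimately show ?thesis by blast
qed

text \<open>
  For \<open>u = u0 + v\<close> with \<open>v\<close> in the nilradical the eigenvectors \<open>e i + \<sigma> e' i\<close> of \<open>ad u0\<close> are
  corrected by central elements; this changes no bracket between them.
\<close>

lemma eigenvector_basis:
  assumes two: "(2 :: 'f) \<noteq> 0" and lam: "\<forall>i\<in>{1..k}. lam i \<noteq> 0"
    and u: "u - u0 \<in> span (insert z0 E)"
  shows "\<exists>F. finite F \<and> paired F \<and>
    (\<forall>f\<in>F. \<exists>\<mu>\<in>lam ` {1..k} \<union> (\<lambda>i. - lam i) ` {1..k}. br u f = scale \<mu> f) \<and>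
    F \<subseteq> span (insert z0 E) \<and> (\<forall>x. x \<in> span (insert z0 (insert u F)))"
proof -
  define p where "p i \<sigma> = e i + scale \<sigma> (e' i)" for i and \<sigma> :: 'f
  let ?S = "{1, -1} :: 'f set"
  have pH: "p i \<sigma> \<in> span (insert z0 E)" if "i \<in> {1..k}" for i \<sigma>
    using that unfolding p_def by (auto intro!: span_add span_scale intro: span_base)
  have br_p: "br (p i \<sigma>) (p j \<tau>) = (if i = j then scale (lam i * (\<tau> - \<sigma>)) z0 else 0)"
    if "i \<in> {1..k}" "j \<in> {1..k}" for i j \<sigma> \<tau>
    unfolding p_def br_add_left br_add_right br_scale_left br_scale_right
      br_e_e'_cases[OF that] br_e_e[OF that] br_e'_e'[OF that]
    by (auto simp: algebra_simps)
  have "\<exists>c. br u (p i \<sigma>) = scale (\<sigma> * lam i) (p i \<sigma>) + scale c z0"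
    if i: "i \<in> {1..k}" and \<sigma>: "\<sigma> \<in> ?S" for i \<sigma>
  proof -
    have "br (u - u0) (p i \<sigma>) \<in> span {z0}" using br_nilradical[OF u pH[OF i]] .
    then obtain c where c: "br (u - u0) (p i \<sigma>) = scale c z0" by (auto simp: span_singleton)
    have "br u0 (p i \<sigma>) = scale (\<sigma> * lam i) (p i \<sigma>)"
      using \<sigma> i unfolding p_def
      by (auto simp: br_add_right br_scale_right br_u_e br_u_e' algebra_simps br_minus_right)
    then show ?thesis using c by (auto simp: br_diff_left algebra_simps)
  qed
  then obtain c where c: "\<And>i \<sigma>. i \<in> {1..k} \<Longrightarrow> \<sigma> \<in> ?S \<Longrightarrow>
      br u (p i \<sigma>) = scale (\<sigma> * lam i) (p i \<sigma>) + scale (c i \<sigma>) z0"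
    by metis
  define f where "f i \<sigma> = p i \<sigma> + scale (c i \<sigma> / (\<sigma> * lam i)) z0" for i \<sigma>
  define F where "F = (\<lambda>(i, \<sigma>). f i \<sigma>) ` ({1..k} \<times> ?S)"
  have F_cases: "\<exists>i\<in>{1..k}. \<exists>\<sigma>\<in>?S. b = f i \<sigma>" if "b \<in> F" for b
    using that unfolding F_def by auto
  have F_mem: "f i \<sigma> \<in> F" if "i \<in> {1..k}" "\<sigma> \<in> ?S" for i \<sigma>
    using that unfolding F_def by force
  have eig: "br u (f i \<sigma>) = scale (\<sigma> * lam i) (f i \<sigma>)" if "i \<in> {1..k}" "\<sigma> \<in> ?S" for i \<sigma>
  proof -
    have "\<sigma> * lam i \<noteq> 0" using that lam by auto
    then show ?thesis
      unfolding f_def using c[OF that]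
      by (simp add: br_add_right br_scale_right z0_central' scale_right_distrib)
  qed
  have br_f: "br (f i \<sigma>) (f j \<tau>) = (if i = j then scale (lam i * (\<tau> - \<sigma>)) z0 else 0)"
    if "i \<in> {1..k}" "j \<in> {1..k}" for i j \<sigma> \<tau>
    unfolding f_def using br_p[OF that]
    by (simp add: br_add_left br_add_right br_scale_left br_scale_right z0_central z0_central')
  \<comment> \<open>The partner of \<open>f i \<sigma>\<close> is \<open>f i (- \<sigma>)\<close>.\<close>
  have sgn: "- \<sigma> \<in> ?S" "- \<sigma> - \<sigma> \<noteq> 0" if "\<sigma> \<in> ?S" for \<sigma>
    using that two by auto
  have "paired F"
    unfolding paired_def
  proof
    fix b assume "b \<in> F"
    then obtain i \<sigma> where i: "i \<in> {1..k}" "\<sigma> \<in> ?S" "b = f i \<sigma>" using F_cases by blast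
    show "\<exists>!c. c \<in> F \<and> br b c \<noteq> 0"
    proof (rule ex1I[of _ "f i (- \<sigma>)"])
      have "lam i * (- \<sigma> - \<sigma>) \<noteq> 0" using lam i(1) sgn(2)[OF i(2)] by simp
      then show "f i (- \<sigma>) \<in> F \<and> br b (f i (- \<sigma>)) \<noteq> 0"
        using F_mem[OF i(1) sgn(1)[OF i(2)]] br_f[OF i(1) i(1)] z0_nonzero i(3) by simp
      fix c assume "c \<in> F \<and> br b c \<noteq> 0"
      then obtain j \<tau> where j: "j \<in> {1..k}" "\<tau> \<in> ?S" "c = f j \<tau>" "br (f i \<sigma>) (f j \<tau>) \<noteq> 0"
        using F_cases i(3) by blast
      then have "j = i" "\<tau> \<noteq> \<sigma>" using br_f[OF i(1) j(1)] by (auto split: if_splits)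
      then show "c = f i (- \<sigma>)" using i(2) j(2,3) by auto
    qed
  qed
  moreover have "\<exists>\<mu>\<in>lam ` {1..k} \<union> (\<lambda>i. - lam i) ` {1..k}. br u b = scale \<mu> b" if "b \<in> F" for b
  proof -
    obtain i \<sigma> where i: "i \<in> {1..k}" "\<sigma> \<in> ?S" "b = f i \<sigma>" using F_cases \<open>b \<in> F\<close> by blast
    then have "\<sigma> * lam i \<in> lam ` {1..k} \<union> (\<lambda>i. - lam i) ` {1..k}" by auto
    then show ?thesis using eig i by blast
  qed
  moreover have "F \<subseteq> span (insert z0 E)"
  proof
    fix b assume "b \<in> F"
    then obtain i \<sigma> where "i \<in> {1..k}" "b = f i \<sigma>" using F_cases by blast
    then show "b \<in> span (insert z0 E)"
      unfolding f_def using pH by (auto intro!: span_add span_scale intro: span_base)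
  qed
  moreover have "x \<in> span (insert z0 (insert u F))" for x
  proof -
    let ?X = "span (insert z0 (insert u F))"
    have z0X: "z0 \<in> ?X" by (simp add: span_base)
    have pX: "p i \<sigma> \<in> ?X" if "i \<in> {1..k}" "\<sigma> \<in> ?S" for i \<sigma>
    proof -
      have "f i \<sigma> \<in> ?X" using F_mem[OF that] by (simp add: span_base)
      moreover have "p i \<sigma> = f i \<sigma> - scale (c i \<sigma> / (\<sigma> * lam i)) z0" by (simp add: f_def)
      ultimately show ?thesis using z0X span_diff span_scale by metis
    qed
    have eX: "e i \<in> ?X" "e' i \<in> ?X" if "i \<in> {1..k}" for i
    proof -
      have half: "scale (1 / 2) (x + x) = x" for x
        using two by (simp add: scale_right_distrib flip: scale_left_distrib)
      have "p i 1 + p i (- 1) = e i + e i" "p i 1 - p i (- 1) = e' i + e' i"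
        by (simp_all add: p_def)
      then have "e i = scale (1 / 2) (p i 1 + p i (- 1))" "e' i = scale (1 / 2) (p i 1 - p i (- 1))"
        using half by metis+
      then show "e i \<in> ?X" "e' i \<in> ?X"
        using span_scale[OF span_add[OF pX[OF that, of 1] pX[OF that, of "- 1"]]]
          span_scale[OF span_diff[OF pX[OF that, of 1] pX[OF that, of "- 1"]]] by simp_all
    qed
    have HX: "span (insert z0 E) \<subseteq> ?X"
      using eX z0X by (intro span_minimal) auto
    have "u0 = u - (u - u0)" by simp
    then have "u0 \<in> ?X"
      using u HX span_diff[of u "insert z0 (insert u F)" "u - u0"] span_base[of u "insert z0 (insert u F)"]
      by auto
    then have "insert u0 (insert z0 E) \<subseteq> ?X"
      using HX span_superset[of "insert z0 E"] by blast
    then show ?thesis using span_basis[of x] span_minimal[OF _ subspace_span] by blast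
  qed
  moreover have "finite F" unfolding F_def by simp
  ultimately show ?thesis by blast
qed

end

text \<open>
  Passing from the defining basis to the homogeneous \<open>u\<close> and its eigenvectors. After this step
  the basis \<open>e\<close>, \<open>e'\<close> enters only through the dimension.
\<close>

lemma twisted_heisenberg_reduction:
  fixes scale :: "'f::{alg_closed_field, field_char_0} \<Rightarrow> 'v::ab_group_add \<Rightarrow> 'v"
    and br :: "'v \<Rightarrow> 'v \<Rightarrow> 'v" and \<Gamma> :: "'g::ab_group_add \<Rightarrow> 'v set"
  assumes L: "twisted_heisenberg scale br k lam z0 u0 e e'"
    and k: "k \<ge> 1" and lam: "\<forall>i\<in>{1..k}. lam i \<noteq> 0"
    and \<Gamma>: "lie_algebra.is_grading scale br \<Gamma>"
    and z: "z \<in> lie_algebra.center br" "z \<noteq> 0"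
  shows "\<exists>u d h F. graded_heisenberg scale br \<Gamma> z u d h F (lam ` {1..k} \<union> (\<lambda>i. - lam i) ` {1..k})
    \<and> (\<forall>x. x \<in> module.span scale (insert z (insert u F)))"
proof -
  interpret L: twisted_heisenberg scale br k lam z0 u0 e e' by (rule L)
  let ?\<Lambda> = "lam ` {1..k} \<union> (\<lambda>i. - lam i) ` {1..k}"
  obtain a where a: "z = scale a z0" using L.center_eq[OF k lam z(1)] by blast
  have "a \<noteq> 0" using a z(2) by auto
  have z0_span: "L.span {z0} = L.span {z}"
  proof -
    have "z0 = scale (inverse a) z" using a \<open>a \<noteq> 0\<close> by simp
    then have "z0 \<in> L.span {z}" using L.span_scale L.span_base by (metis singletonI)
    moreover have "z \<in> L.span {z0}" using a L.span_scale L.span_base by (metis singletonI)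
    ultimately show ?thesis by (simp add: L.span_eq)
  qed
  obtain u where u: "homogeneous \<Gamma> u" "u - u0 \<in> L.span (insert z0 L.E)"
    using L.homogeneous_derivation[OF k lam \<Gamma>] by blast
  then obtain h where h: "u \<in> \<Gamma> h" unfolding homogeneous_def by blast
  obtain F where F: "finite F" "L.paired F" "\<forall>f\<in>F. \<exists>\<mu>\<in>?\<Lambda>. br u f = scale \<mu> f"
    "F \<subseteq> L.span (insert z0 L.E)" and span: "\<And>x. x \<in> L.span (insert z0 (insert u F))"
    using L.eigenvector_basis[OF _ lam u(2)] by auto
  have span': "x \<in> L.span (insert z (insert u F))" for x
  proof -
    have "z0 \<in> L.span (insert z (insert u F))"
      using z0_span L.span_base[of z0 "{z0}"] L.span_mono[of "{z}" "insert z (insert u F)"] by auto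
    then have "insert z0 (insert u F) \<subseteq> L.span (insert z (insert u F))"
      using L.span_superset[of "insert z (insert u F)"] by blast
    then show ?thesis using span[of x] L.span_minimal[OF _ L.subspace_span] by blast
  qed
  have nz: "0 \<notin> ?\<Lambda>" using lam by auto
  have z_br: "br z x = 0" "br x z = 0" for x
    using a L.z0_central L.z0_central' by (simp_all add: L.br_scale_left L.br_scale_right)
  have F_br: "br f f' \<in> L.span {z}" if "f \<in> F" "f' \<in> F" for f f'
    using L.br_nilradical that F(4) z0_span by blast
  \<comment> \<open>Without eigenvectors the central \<open>z\<close> and \<open>u\<close> would span \<open>L\<close>, which would be abelian.\<close>
  have "F \<noteq> {}"
  proof
    assume F0: "F = {}"
    have "br u0 (e 1) \<in> L.span {z}"
    proof (rule L.br_in_subspace_left[OF span'[of u0] L.subspace_span])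
      fix b assume "b \<in> insert z (insert u F)"
      then have "b = z \<or> b = u" using F0 by blast
      moreover have "br u (e 1) \<in> L.span {z}"
      proof (rule L.br_in_subspace_right[OF span'[of "e 1"] L.subspace_span])
        show "br u b \<in> L.span {z}" if "b \<in> insert z (insert u F)" for b
          using that F0 z_br L.br_self L.span_zero by auto
      qed
      ultimately show "br b (e 1) \<in> L.span {z}" using z_br L.span_zero by auto
    qed
    then have "scale (lam 1) (e' 1) \<in> L.span {z0}" using L.br_u_e[of 1] k z0_span by simp
    then have "scale (inverse (lam 1)) (scale (lam 1) (e' 1)) \<in> L.span {z0}"
      using L.span_scale by blast
    then show False using L.e'_not_central[of 1] lam k by simp
  qed
  \<comment> \<open>The span of the eigenvectors is the image of \<open>ad u\<close>, hence graded.\<close>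
  have ad_u: "br u x \<in> L.span F" for x
  proof (rule L.br_in_subspace_right[OF span'[of x] L.subspace_span])
    show "br u b \<in> L.span F" if "b \<in> insert z (insert u F)" for b
      using that F(3) z_br L.br_self L.span_zero L.span_base L.span_scale by (metis insertE)
  qed
  have F_graded: "L.span F \<subseteq> L.span {x \<in> L.span F. homogeneous \<Gamma> x}" (is "_ \<subseteq> L.span ?H")
  proof (rule L.span_minimal[OF _ L.subspace_span], rule subsetI)
    fix f assume f: "f \<in> F"
    then obtain \<mu> where \<mu>: "\<mu> \<in> ?\<Lambda>" "br u f = scale \<mu> f" using F(3) by blast
    have "br u f \<in> L.span ?H"
    proof (rule L.br_in_subspace_right[OF L.grading_span_homogeneous[OF \<Gamma>] L.subspace_span])
      fix y assume "y \<in> {y. homogeneous \<Gamma> y}"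
      then have "homogeneous \<Gamma> (br u y)"
        using L.grading_br[OF \<Gamma> h] unfolding homogeneous_def by blast
      then show "br u y \<in> L.span ?H" using ad_u by (intro L.span_base) blast
    qed
    then have "scale (inverse \<mu>) (br u f) \<in> L.span ?H" using L.span_scale by blast
    moreover have "\<mu> \<noteq> 0" using \<mu>(1) nz by blast
    ultimately show "f \<in> L.span ?H" using \<mu>(2) by simp
  qed
  \<comment> \<open>The line of \<open>z\<close> contains a nonzero bracket of homogeneous elements.\<close>
  have "\<exists>d. z \<in> \<Gamma> d"
  proof -
    obtain f where f: "f \<in> F" using \<open>F \<noteq> {}\<close> by blast
    then obtain f' where f': "f' \<in> F" "br f f' \<noteq> 0" using F(2) unfolding L.paired_def by blast
    let ?H = "{x \<in> L.span F. homogeneous \<Gamma> x}"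
    have in_H: "f \<in> L.span ?H" "f' \<in> L.span ?H" using f f' F_graded L.span_base by blast+
    obtain x where x: "x \<in> ?H" "br x f' \<noteq> 0" using L.br_span_eq_0_left[OF in_H(1)] f'(2) by blast
    obtain y where y: "y \<in> ?H" "br x y \<noteq> 0" using L.br_span_eq_0_right[OF in_H(2)] x(2) by blast
    obtain g g' where g: "x \<in> \<Gamma> g" "y \<in> \<Gamma> g'" using x y unfolding homogeneous_def by blast
    have "L.span F \<subseteq> L.span (insert z0 L.E)" using L.span_minimal[OF F(4) L.subspace_span] .
    then have "br x y \<in> L.span {z}" using L.br_nilradical x(1) y(1) z0_span by blast
    then obtain c where c: "br x y = scale c z" by (auto simp: L.span_singleton)
    have "scale (inverse c) (br x y) \<in> \<Gamma> (g + g')"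
      using L.grading_br[OF \<Gamma> g] L.subspace_scale[OF L.grading_subspace[OF \<Gamma>]] by blast
    moreover have "c \<noteq> 0" using c y(2) by auto
    ultimately have "z \<in> \<Gamma> (g + g')" using c by simp
    then show ?thesis by blast
  qed
  then obtain d where d: "z \<in> \<Gamma> d" by blast
  have "graded_heisenberg scale br \<Gamma> z u d h F ?\<Lambda>"
    by unfold_locales (use \<Gamma> z(2) d z_br h F \<open>F \<noteq> {}\<close> F_br nz F_graded in blast)+
  then show ?thesis using span' by blast
qed

theorem theorem3:
  fixes scale :: "'f::{alg_closed_field, field_char_0} \<Rightarrow> 'v::ab_group_add \<Rightarrow> 'v"
    and br :: "'v \<Rightarrow> 'v \<Rightarrow> 'v"
    and k n :: nat
    and lam :: "nat \<Rightarrow> 'f"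
    and z0 u0 z :: 'v
    and e e' :: "nat \<Rightarrow> 'v"
    and \<Gamma> :: "'g::ab_group_add \<Rightarrow> 'v set"
  assumes "k \<ge> 1" and "n = 2 * k + 2"
    and "\<forall>i \<in> {1..k}. lam i \<noteq> 0"
    and "twisted_heisenberg scale br k lam z0 u0 e e'"
    and "finitely_generated TYPE('g)"
    and "lie_algebra.is_grading scale br \<Gamma>"
    and "z \<in> lie_algebra.center br" and "z \<noteq> 0"
  shows "\<exists>(u :: 'v) (l :: nat) (s :: nat) (r :: nat)
            (\<beta> :: nat \<Rightarrow> 'f) (\<alpha> :: nat \<Rightarrow> 'f)
            (x :: nat \<Rightarrow> nat \<Rightarrow> 'v) (y :: nat \<Rightarrow> nat \<Rightarrow> 'v) (w :: nat \<Rightarrow> nat \<Rightarrow> 'v).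
     l \<ge> 1 \<and> l * (r + 2 * s) = 2 * k \<and> 2 * k = n - 2 \<and> (odd l \<longrightarrow> r = 0) \<and>
     (\<forall>j \<in> {1..s}. \<beta> j \<in> lam ` {1..k} \<union> (\<lambda>i. - lam i) ` {1..k}) \<and>
     (\<forall>i \<in> {1..r}. \<alpha> i \<in> lam ` {1..k} \<union> (\<lambda>i. - lam i) ` {1..k}) \<and>
     (\<forall>j \<in> {1..s}. lie_algebra.block_I scale br z u (\<beta> j) l (x j) (y j)) \<and>
     (\<forall>i \<in> {1..r}. lie_algebra.block_II scale br z u (\<alpha> i) (l div 2) (w i)) \<and>
     (\<forall>j \<in> {1..s}. \<forall>j' \<in> {1..s}. j \<noteq> j' \<longrightarrow>
        lie_algebra.brackets_vanish br
          (block_I_set l (x j) (y j)) (block_I_set l (x j') (y j'))) \<and>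
     (\<forall>i \<in> {1..r}. \<forall>i' \<in> {1..r}. i \<noteq> i' \<longrightarrow>
        lie_algebra.brackets_vanish br
          (block_II_set (l div 2) (w i)) (block_II_set (l div 2) (w i'))) \<and>
     (\<forall>j \<in> {1..s}. \<forall>i \<in> {1..r}.
        lie_algebra.brackets_vanish br
          (block_I_set l (x j) (y j)) (block_II_set (l div 2) (w i))) \<and>
     (let B = {z, u} \<union> (\<Union>j \<in> {1..s}. block_I_set l (x j) (y j))
                     \<union> (\<Union>i \<in> {1..r}. block_II_set (l div 2) (w i))
      in lie_algebra.is_basis scale B \<and> (\<forall>b \<in> B. homogeneous \<Gamma> b))"
proof -
  interpret L: twisted_heisenberg scale br k lam z0 u0 e e' by (rule assms(4))
  let ?\<Lambda> = "lam ` {1..k} \<union> (\<lambda>i. - lam i) ` {1..k}"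
  obtain u d h F where G: "graded_heisenberg scale br \<Gamma> z u d h F ?\<Lambda>"
    and span: "\<And>x. x \<in> L.span (insert z (insert u F))"
    using twisted_heisenberg_reduction[OF assms(4,1,3,6,7,8)] by blast
  interpret G: graded_heisenberg scale br \<Gamma> z u d h F ?\<Lambda> by (rule G)
  obtain s r \<beta> \<alpha> x y w where fam: "G.block_family s r \<beta> \<alpha> x y w"
    and span_B: "L.span (G.family_set s r x y w) = L.span F"
    using G.spanning_block_family by blast
  define B where "B = G.family_set s r x y w"
  note B = G.block_family_properties(1,2,3)[OF fam, folded B_def]
  have z_B: "z \<notin> L.span B"
    using L.paired_nondegenerate[OF B(1), of z] G.z by blast
  \<comment> \<open>Elements of this span map \<open>W\<close> into the line of \<open>z\<close>, while \<open>ad u\<close> rescales \<open>f\<close>, which is not central.\<close>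
  have u_B: "u \<notin> L.span (insert z B)"
  proof
    assume u: "u \<in> L.span (insert z B)"
    obtain f where f: "f \<in> F" using G.F(2) by blast
    then obtain \<mu> where \<mu>: "\<mu> \<in> ?\<Lambda>" "br u f = scale \<mu> f" using G.F_eigenvector by blast
    have fB: "f \<in> L.span F" using f L.span_base by blast
    have "br u f \<in> L.span {z}"
    proof (rule L.br_in_subspace_left[OF u L.subspace_span])
      fix b assume "b \<in> insert z B"
      then have "b = z \<or> b \<in> L.span F" using span_B L.span_base unfolding B_def by blast
      then show "br b f \<in> L.span {z}"
        using G.z(3) L.span_zero G.br_W[OF _ fB] L.span_scale L.span_base by (metis singletonI)
    qed
    then have "br (br u f) b = 0" for b
      using L.br_span_eq_0_left[of "br u f" "{z}" b] G.z(3) by blast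
    moreover have "\<mu> \<noteq> 0" using \<mu>(1) G.eigenvalue_nonzero by blast
    ultimately have "br f b = 0" for b using \<mu>(2) by (simp add: L.br_scale_left)
    then show False using G.F(3) f unfolding L.paired_def by blast
  qed
  have indep: "L.independent (insert u (insert z B))"
    using L.independent_insertI[OF u_B L.independent_insertI[OF z_B L.paired_independent[OF B(1)]]] .
  have span_all: "v \<in> L.span (insert u (insert z B))" for v
  proof -
    have "F \<subseteq> L.span B" using span_B L.span_superset unfolding B_def by blast
    then have "insert z (insert u F) \<subseteq> L.span (insert u (insert z B))"
      using L.span_mono[of B "insert u (insert z B)"] L.span_superset[of "insert u (insert z B)"] by blast
    then show ?thesis using span[of v] L.span_minimal[OF _ L.subspace_span] by blast
  qed
  have "card (insert u (insert z B)) = 2 * k + 2"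
  proof (rule antisym)
    let ?X = "{z0, u0} \<union> e ` {1..k} \<union> e' ` {1..k}"
    have X: "L.independent ?X" "L.span ?X = UNIV" "finite ?X" "card ?X = 2 * k + 2"
      using L.basis L.basis_card unfolding L.is_basis_def by auto
    show "card (insert u (insert z B)) \<le> 2 * k + 2"
      using L.independent_span_bound[OF X(3) indep] X(2,4) by auto
    show "2 * k + 2 \<le> card (insert u (insert z B))"
      using L.independent_span_bound[OF _ X(1), of "insert u (insert z B)"] X(4) span_all B(2) by auto
  qed
  moreover have "z \<notin> B" "u \<notin> insert z B" using z_B u_B L.span_base by blast+
  ultimately have card: "G.l * (r + 2 * s) = 2 * k" using B(2,3) by simp
  have basis_eq: "{z, u} \<union> (\<Union>j \<in> {1..s}. block_I_set G.l (x j) (y j))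
      \<union> (\<Union>i \<in> {1..r}. block_II_set (G.l div 2) (w i)) = insert u (insert z B)"
    unfolding B_def G.family_set_def by blast
  have basis: "L.is_basis (insert u (insert z B))"
    unfolding L.is_basis_def using indep span_all by blast
  have homogeneous: "\<forall>b\<in>insert u (insert z B). homogeneous \<Gamma> b"
    using fam G.u G.z(2) unfolding G.block_family_def B_def homogeneous_def by blast
  have n: "2 * k = n - 2" using assms(2) by simp
  show ?thesis
    by (insert fam[unfolded G.block_family_def] G.l_pos card n basis homogeneous, elim conjE,
        rule exI[of _ u], rule exI[of _ G.l], rule exI[of _ s], rule exI[of _ r], rule exI[of _ \<beta>],
        rule exI[of _ \<alpha>], rule exI[of _ x], rule exI[of _ y], rule exI[of _ w],
        unfold Let_def basis_eq, intro conjI; assumption)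
qed

end
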